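(* Any countable (finite or infinite) product of locally connected curves belongs to the class $0\text{-}DIM$; that is, if $X$ is such a product, then $C_0(X,X)$ is a dense $G_\delta$-subset of $C(X,X)$.
   Context: A continuum is a compact connected metric space; a curve is a one-dimensional continuum. For compact metric $X,Y$, $C(X,Y)$ is the space of continuous maps $X\to Y$ with the topology of uniform convergence. A map $f:X\to Y$ is $n$-dimensional if all its fibers $f^{-1}(y)$, $y\in Y$, have covering dimension at most $n$; $C_n(X,Y)$ is the set of all $n$-dimensional maps in $C(X,Y)$. A compact metric space $X$ is in the class $0\text{-}DIM$ if $C_0(X,X)$ is a dense $G_\delta$-subset of $C(X,X)$. *)

theory Defs
  imports "HOL-Analysis.Analysis"
begin

text \<open>
  All spaces are values of type \<open>'a topology\<close>; a compact metric space is a compact metrizable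
  topology. A metric is chosen only where uniform convergence needs one.
\<close>

text \<open>
  Covering dimension at most \<open>n\<close>: every finite open cover has a finite open refinement of order at
  most \<open>n\<close>, i.e. no point lies in more than \<open>n + 1\<close> members. The empty space (dimension \<open>-1\<close>)
  satisfies this for every \<open>n\<close>.
\<close>

definition covering_dim_le :: "'a topology \<Rightarrow> nat \<Rightarrow> bool" where
  "covering_dim_le X n \<longleftrightarrow>
     (\<forall>\<U>. finite \<U> \<and> (\<forall>U\<in>\<U>. openin X U) \<and> \<Union>\<U> = topspace X \<longrightarrow>
       (\<exists>\<V>. finite \<V> \<and> (\<forall>V\<in>\<V>. openin X V) \<and> \<Union>\<V> = topspace X \<and>
            (\<forall>V\<in>\<V>. \<exists>U\<in>\<U>. V \<subseteq> U) \<and>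
            (\<forall>x\<in>topspace X. card {V\<in>\<V>. x \<in> V} \<le> n + 1)))"

definition continuum :: "'a topology \<Rightarrow> bool" where
  "continuum X \<longleftrightarrow> metrizable_space X \<and> compact_space X \<and> connected_space X"

definition curve :: "'a topology \<Rightarrow> bool" where
  "curve X \<longleftrightarrow> continuum X \<and> covering_dim_le X 1 \<and> \<not> covering_dim_le X 0"

text \<open>
  The space \<open>C(X,Y)\<close> is the library's \<^const>\<open>cfunspace\<close>, which carries the supremum metric; for compact
  \<open>X\<close> its boundedness requirement is automatic. Its elements are taken to be undefined off
  \<open>topspace X\<close>, so that each map is represented by exactly one HOL function.
\<close>

definition n_dimensional_maps :: "nat \<Rightarrow> 'a topology \<Rightarrow> 'b metric \<Rightarrow> ('a \<Rightarrow> 'b) set" where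
  "n_dimensional_maps n X m =
     {f \<in> mspace (cfunspace X m).
        \<forall>y\<in>mspace m. covering_dim_le (subtopology X {x \<in> topspace X. f x = y}) n}"

text \<open>
  For compact \<open>X\<close> the topology of uniform convergence on \<open>C(X,X)\<close> does not depend on the choice of
  a compatible metric; the definition quantifies over all of them.
\<close>

definition zero_DIM :: "'a topology \<Rightarrow> bool" where
  "zero_DIM X \<longleftrightarrow> compact_space X \<and> metrizable_space X \<and>
     (\<forall>m. mtopology_of m = X \<longrightarrow>
        gdelta_in (mtopology_of (cfunspace X m)) (n_dimensional_maps 0 X m) \<and>
        mtopology_of (cfunspace X m) closure_of n_dimensional_maps 0 X m = mspace (cfunspace X m))"

end

theory Submission
  imports Defs
begin

text \<open>
  The proof is a Baire category argument in the complete metric space \<open>C(X,X)\<close>.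

  For \<open>\<delta> > 0\<close> call a map \<open>f\<close> \<open>\<delta>\<close>-splitting if every point \<open>x\<close> lies in a piece of diameter
  less than \<open>\<delta>\<close> that two disjoint open sets cut off from the rest of the fibre of \<open>f\<close> through \<open>x\<close>
  (\<open>split_maps\<close>). By compactness the \<open>\<delta>\<close>-splitting maps form an open set (\<open>openin_split_maps\<close>), and
  a map is zero-dimensional iff it is \<open>\<delta>\<close>-splitting for every \<open>\<delta>\<close> (\<open>zero_dimensional_maps_eq\<close>). So it
  is enough to approximate an arbitrary \<open>f\<close> by \<open>\<delta>\<close>-splitting maps (\<open>zero_DIM_I\<close>).

  Finitely many coordinates \<open>J\<close> determine points of the product up to a small error,
  so \<open>f\<close> may be assumed to depend on the coordinates in \<open>J\<close> only. Each \<open>f\<^sub>i\<close> with \<open>i \<in> J\<close> is then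
  replaced by
  \<open>g\<^sub>i x = H\<^sub>i (f\<^sub>i x, \<theta>\<^sub>i (x\<^sub>i))\<close>, where the two ingredients come from the two hypotheses on the factors:

  \<^item> \<open>\<theta>\<^sub>i : X\<^sub>i \<rightarrow> [0,1]\<close> uses that \<open>X\<^sub>i\<close> has dimension at most one: for every \<open>t\<close> the set \<open>{\<theta>\<^sub>i \<noteq> t}\<close> falls apart into
    tiny relatively clopen pieces (\<open>dim_1_separating_function\<close>).
  \<^item> \<open>H\<^sub>i : X\<^sub>i \<times> [0,1] \<rightarrow> X\<^sub>i\<close> uses that \<open>X\<^sub>i\<close> is a locally connected nondegenerate continuum of dimension
    at most one: \<open>H\<^sub>i\<close> is close to the projection, yet for every \<open>y\<close> the path \<open>H\<^sub>i (y, \<cdot>)\<close> is not constant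
    (\<open>nonconstant_motion\<close>).

  Consider the fibre of \<open>g\<close> over \<open>w\<close> and a point \<open>x\<close> in it. Since \<open>H\<^sub>i (f\<^sub>i x, \<cdot>)\<close> is not constant, some time
  \<open>t\<^sub>i\<close> satisfies \<open>H\<^sub>i (f\<^sub>i x, t\<^sub>i) \<noteq> w\<^sub>i\<close>, and by compactness this persists for all points \<open>y\<close> within a
  uniform distance of \<open>f\<^sub>i x\<close> (\<open>nonconstant_motion_avoids\<close>). If \<open>z\<close> is in the fibre and its \<open>J\<close>-coordinates are
  close to those of \<open>x\<close>, then \<open>f\<^sub>i z\<close> is close to \<open>f\<^sub>i x\<close>, so \<open>\<theta>\<^sub>i (z\<^sub>i) \<noteq> t\<^sub>i\<close>. Hence near \<open>x\<close> the fibre avoids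
  all the walls \<open>{\<theta>\<^sub>i = t\<^sub>i}\<close>, and the box of the tiny pieces containing the \<open>x\<^sub>i\<close> is relatively clopen in it
  (\<open>split_maps_dense_product\<close>).

  The motion \<open>H\<close> is built over the decomposition of the curve into two families of small open
  sets: on a member of either family it follows a fixed short nonconstant path, and between a member of
  one and a member of the other it slides a window along the concatenation of the two paths
  (\<open>nonconstant_path_homotopy\<close>). The short paths exist because a compact locally connected metric space is
  uniformly locally path connected (\<open>path_near_connected\<close>).
\<close>

section \<open>Short paths in locally connected compact metric spaces\<close>

lemma nat_floor_mult_div:
  fixes t :: real
  assumes "t \<ge> 0" "m \<ge> 1"
  shows "nat \<lfloor>real (L*m) * t\<rfloor> div m = nat \<lfloor>real L * t\<rfloor>"
proof -
  have "\<lfloor>(real (L*m) * t) / real_of_int (int m)\<rfloor> = \<lfloor>real (L*m) * t\<rfloor> div int m"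
    by (rule floor_divide_real_eq_div) simp
  moreover have "(real (L*m) * t) / real_of_int (int m) = real L * t" using assms by simp
  ultimately have "\<lfloor>real L * t\<rfloor> = \<lfloor>real (L*m) * t\<rfloor> div int m" by simp
  then show ?thesis using assms by (simp add: nat_div_distrib)
qed

lemma nat_floor_close:
  fixes a b :: real
  assumes "\<bar>a - b\<bar> < 1"
  shows "nat \<lfloor>a\<rfloor> = nat \<lfloor>b\<rfloor> \<or> nat \<lfloor>a\<rfloor> = Suc (nat \<lfloor>b\<rfloor>) \<or> nat \<lfloor>b\<rfloor> = Suc (nat \<lfloor>a\<rfloor>)"
proof -
  have "\<bar>\<lfloor>a\<rfloor> - \<lfloor>b\<rfloor>\<bar> \<le> 1" using assms by linarith
  then show ?thesis by linarith
qed

context Metric_space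
begin

lemma compact_cover_Lebesgue_number:
  assumes cpt: "compact_space mtopology"
    and op: "\<And>U. U \<in> \<U> \<Longrightarrow> openin mtopology U" and cov: "M \<subseteq> \<Union>\<U>"
  obtains r where "r > 0" "\<And>x. x \<in> M \<Longrightarrow> \<exists>U\<in>\<U>. mball x r \<subseteq> U"
proof -
  have "\<exists>e>0. \<exists>U\<in>\<U>. mball x (2*e) \<subseteq> U" if x: "x \<in> M" for x
  proof -
    obtain U where U: "U \<in> \<U>" "x \<in> U" using cov x by blast
    then obtain s where "s > 0" "mball x s \<subseteq> U"
      using op openin_mtopology by meson
    with U show ?thesis by (intro exI[of _ "s/2"]) auto
  qed
  then obtain e where e: "\<And>x. x \<in> M \<Longrightarrow> e x > 0 \<and> (\<exists>U\<in>\<U>. mball x (2 * e x) \<subseteq> U)"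
    by metis
  have "\<forall>U\<in>(\<lambda>x. mball x (e x)) ` M. openin mtopology U" "M \<subseteq> \<Union>((\<lambda>x. mball x (e x)) ` M)"
    using e by auto
  then obtain \<F> where \<F>: "finite \<F>" "\<F> \<subseteq> (\<lambda>x. mball x (e x)) ` M" "M \<subseteq> \<Union>\<F>"
    using cpt unfolding compact_space_alt topspace_mtopology by meson
  then obtain K where K: "finite K" "K \<subseteq> M" "\<F> = (\<lambda>x. mball x (e x)) ` K"
    using finite_subset_image[OF \<F>(1,2)] by blast
  then have K3: "M \<subseteq> (\<Union>x\<in>K. mball x (e x))" using \<F> by simp
  define r where "r = Min (insert 1 (e ` K))"
  have r: "r > 0" "\<And>x. x \<in> K \<Longrightarrow> r \<le> e x"
    using K e by (auto simp: r_def)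
  have "\<exists>U\<in>\<U>. mball y r \<subseteq> U" if y: "y \<in> M" for y
  proof -
    obtain x where x: "x \<in> K" "y \<in> mball x (e x)" using K3 y by blast
    have "mball y r \<subseteq> mball x (2 * e x)"
    proof
      fix z assume "z \<in> mball y r"
      then show "z \<in> mball x (2 * e x)"
        using x r(2)[OF x(1)] triangle[of x y z] by auto
    qed
    then show ?thesis using e[of x] x K by blast
  qed
  with r that show thesis by blast
qed

lemma uniformly_locally_connected:
  assumes cpt: "compact_space mtopology" and lc: "locally_connected_space mtopology" and "\<epsilon> > 0"
  obtains \<delta> where "\<delta> > 0"
    "\<And>x y. \<lbrakk>x \<in> M; y \<in> M; d x y < \<delta>\<rbrakk>
       \<Longrightarrow> \<exists>C. connectedin mtopology C \<and> x \<in> C \<and> y \<in> C \<and> C \<subseteq> mball x \<epsilon>"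
proof -
  define \<U> where "\<U> = {U. openin mtopology U \<and>
      (\<exists>C. connectedin mtopology C \<and> U \<subseteq> C \<and> (\<forall>a\<in>C. \<forall>b\<in>C. d a b < \<epsilon>))}"
  have "M \<subseteq> \<Union>\<U>"
  proof
    fix x assume x: "x \<in> M"
    have "neighbourhood_base_at x (connectedin mtopology) mtopology"
      using lc x by (simp add: locally_connected_space_def neighbourhood_base_of_def)
    then obtain U C where UC: "openin mtopology U" "connectedin mtopology C" "x \<in> U" "U \<subseteq> C" 
        "C \<subseteq> mball x (\<epsilon>/2)"
      unfolding neighbourhood_base_at_def
      by (metis \<open>\<epsilon> > 0\<close> centre_in_mball_iff half_gt_zero openin_mball x)
    have "d a b < \<epsilon>" if "a \<in> C" "b \<in> C" for a b
    proof -
      have "a \<in> mball x (\<epsilon>/2)" "b \<in> mball x (\<epsilon>/2)" using that UC by auto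
      then show ?thesis using triangle[of a x b] commute[of a x] by auto
    qed
    then show "x \<in> \<Union>\<U>" unfolding \<U>_def using UC by blast
  qed
  then obtain r where r: "r > 0" "\<And>x. x \<in> M \<Longrightarrow> \<exists>U\<in>\<U>. mball x r \<subseteq> U"
    by (rule compact_cover_Lebesgue_number[OF cpt, rotated]) (auto simp: \<U>_def)
  show thesis
  proof
    fix x y assume xy: "x \<in> M" "y \<in> M" "d x y < r"
    then obtain U where U: "U \<in> \<U>" "mball x r \<subseteq> U" using r by blast
    then obtain C where C: "connectedin mtopology C" "U \<subseteq> C" "\<forall>a\<in>C. \<forall>b\<in>C. d a b < \<epsilon>"
      unfolding \<U>_def by blast
    moreover have "x \<in> C" "y \<in> C" using U C xy r(1) by auto
    moreover have "C \<subseteq> M" using C connectedin_subset_topspace by fastforce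
    ultimately show "\<exists>C. connectedin mtopology C \<and> x \<in> C \<and> y \<in> C \<and> C \<subseteq> mball x \<epsilon>"
      using xy by (intro exI[of _ C]) auto
  qed (use r in auto)
qed

text \<open>
  Chains are sequences that stay at their final point from index \<open>n\<close> on. Finitely many chains can thus
  be regarded as having one common length, which makes the subdivision in \<open>chain_refine\<close> uniform.
\<close>
definition is_chain :: "real \<Rightarrow> 'a set \<Rightarrow> 'a \<Rightarrow> 'a \<Rightarrow> nat \<Rightarrow> (nat \<Rightarrow> 'a) \<Rightarrow> bool" where
  "is_chain \<delta> C x y n c \<longleftrightarrow> c 0 = x \<and> (\<forall>i\<ge>n. c i = y) \<and> (\<forall>i. c i \<in> C) \<and> (\<forall>i. d (c i) (c (Suc i)) < \<delta>)"

text \<open>The points of \<open>C\<close> that are reachable from \<open>x\<close> by \<open>\<delta>\<close>-chains form a clopen subset of \<open>C\<close>.\<close>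
lemma connected_imp_chain:
  assumes con: "connectedin mtopology C" and "x \<in> C" "y \<in> C" "\<delta> > 0"
  shows "\<exists>n c. is_chain \<delta> C x y n c"
proof -
  have CM: "C \<subseteq> M" using con connectedin_subset_topspace by fastforce
  define R where "R = {z \<in> C. \<exists>n c. is_chain \<delta> C x z n c}"
  have step: "b \<in> R" if ab: "a \<in> R" "b \<in> C" "d a b < \<delta>" for a b
  proof -
    obtain n c where c: "is_chain \<delta> C x a n c" using ab unfolding R_def by blast
    have "is_chain \<delta> C x b (Suc n) (\<lambda>i. if i \<le> n then c i else b)"
      unfolding is_chain_def
    proof (intro conjI allI impI)
      fix i
      show "(if i \<le> n then c i else b) \<in> C" using c that unfolding is_chain_def by simp
      have "i < n \<or> i = n \<or> i > n" by arith
      then show "d (if i \<le> n then c i else b) (if Suc i \<le> n then c (Suc i) else b) < \<delta>"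
      proof (elim disjE)
        assume "i = n"
        moreover have "c n = a" using c unfolding is_chain_def by blast
        ultimately show ?thesis using that by simp
      next
        assume "i > n"
        then show ?thesis using that CM \<open>\<delta> > 0\<close> by (simp add: subsetD)
      qed (use c in \<open>simp add: is_chain_def\<close>)
    qed (use c in \<open>auto simp: is_chain_def\<close>)
    then show ?thesis using that unfolding R_def by blast
  qed
  have "x \<in> R"
  proof -
    have "is_chain \<delta> C x x 0 (\<lambda>_. x)" using assms CM by (simp add: is_chain_def subsetD)
    then show ?thesis unfolding R_def using \<open>x \<in> C\<close> by blast
  qed
  define U V where "U = (\<Union>a\<in>R. mball a \<delta>)" and "V = (\<Union>a\<in>C-R. mball a \<delta>)"
  have "openin mtopology U" "openin mtopology V" by (auto simp: U_def V_def)
  moreover have "C \<subseteq> U \<union> V" using CM \<open>\<delta> > 0\<close> by (force simp: U_def V_def)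
  moreover have "U \<inter> V \<inter> C = {}"
  proof -
    have False if z: "z \<in> C" "a \<in> R" "b \<in> C - R" "z \<in> mball a \<delta>" "z \<in> mball b \<delta>" for z a b
    proof -
      have "z \<in> R" using step[of a z] z by auto
      then have "b \<in> R" using step[of z b] z commute by auto
      with z show False by auto
    qed
    then show ?thesis unfolding U_def V_def by blast
  qed
  moreover have "U \<inter> C \<noteq> {}" using \<open>x \<in> R\<close> \<open>x \<in> C\<close> CM \<open>\<delta> > 0\<close> unfolding U_def by fastforce
  ultimately have "V \<inter> C = {}" using con unfolding connectedin by blast
  then have "C \<subseteq> R" using CM \<open>\<delta> > 0\<close> unfolding V_def by fastforce
  then show ?thesis using \<open>y \<in> C\<close> unfolding R_def by blast
qed

text \<open>
  Every step of the coarse chain is replaced by a finer chain inside a small connected set that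
  contains both ends of the step. All these chains are given the same length \<open>m\<close>, so that index \<open>j\<close> of
  the refinement lies over index \<open>j div m\<close> of the coarse chain.
\<close>
lemma chain_refine:
  assumes ulc: "\<And>x y. \<lbrakk>x \<in> M; y \<in> M; d x y < \<delta>\<rbrakk>
       \<Longrightarrow> \<exists>C. connectedin mtopology C \<and> x \<in> C \<and> y \<in> C \<and> C \<subseteq> mball x \<epsilon>"
    and c: "is_chain \<delta> M x y n c" and "\<delta>' > 0" "\<epsilon> > 0"
  obtains m c' where "m \<ge> 1" "is_chain \<delta>' M x y (n*m) c'" "\<forall>j. d (c (j div m)) (c' j) < \<epsilon>"
proof -
  have c0: "c 0 = x" and cn: "\<And>i. i \<ge> n \<Longrightarrow> c i = y" and cM: "\<And>i. c i \<in> M"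
    and cd: "\<And>i. d (c i) (c (Suc i)) < \<delta>"
    using c unfolding is_chain_def by auto
  have yM: "y \<in> M" using cM[of n] cn[of n] by simp
  have "\<exists>k b. is_chain \<delta>' (mball (c i) \<epsilon>) (c i) (c (Suc i)) k b" for i
  proof -
    obtain C where C: "connectedin mtopology C" "c i \<in> C" "c (Suc i) \<in> C" "C \<subseteq> mball (c i) \<epsilon>"
      using ulc[OF cM cM cd] by blast
    obtain k b where "is_chain \<delta>' C (c i) (c (Suc i)) k b"
      using connected_imp_chain[OF C(1-3) \<open>\<delta>' > 0\<close>] by blast
    then have "is_chain \<delta>' (mball (c i) \<epsilon>) (c i) (c (Suc i)) k b"
      using C(4) unfolding is_chain_def by blast
    then show ?thesis by blast
  qed
  then obtain k b where b: "\<And>i. is_chain \<delta>' (mball (c i) \<epsilon>) (c i) (c (Suc i)) (k i) (b i)"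
    by metis
  have b0: "\<And>i. b i 0 = c i" and bk: "\<And>i j. j \<ge> k i \<Longrightarrow> b i j = c (Suc i)"
    and bM: "\<And>i j. b i j \<in> mball (c i) \<epsilon>" and bd: "\<And>i j. d (b i j) (b i (Suc j)) < \<delta>'"
    using b unfolding is_chain_def by auto
  \<comment> \<open>The successor makes the last entry of each block already equal to the first one of the next.\<close>
  define m where "m = Suc (Max (insert 0 (k ` {..<n})))"
  have m1: "m \<ge> 1" by (simp add: m_def)
  have km: "k i \<le> m - 1" if "i < n" for i
    using that by (simp add: m_def)
  define c' where "c' j = (if j div m < n then b (j div m) (j mod m) else y)" for j
  have c'M: "c' j \<in> M" for j
    using bM[of "j div m" "j mod m"] yM by (simp add: c'_def)
  show thesis
  proof
    show "m \<ge> 1" by fact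
    show "\<forall>j. d (c (j div m)) (c' j) < \<epsilon>"
    proof
      fix j
      show "d (c (j div m)) (c' j) < \<epsilon>"
        using bM[of "j div m" "j mod m"] yM \<open>\<epsilon> > 0\<close> cn[of "j div m"] by (simp add: c'_def)
    qed
    show "is_chain \<delta>' M x y (n*m) c'"
      unfolding is_chain_def
    proof (intro conjI allI impI)
      show "c' 0 = x"
        using b0[of 0] c0 cn[of 0] by (simp add: c'_def)
      fix i
      show "c' i = y" if "n * m \<le> i"
      proof -
        have "n \<le> i div m" using that m1 by (simp add: less_eq_div_iff_mult_less_eq)
        then show ?thesis by (simp add: c'_def)
      qed
      show "c' i \<in> M" by (rule c'M)
      show "d (c' i) (c' (Suc i)) < \<delta>'"
      proof (cases "i div m < n")
        case False
        then have "n \<le> Suc i div m"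
          using div_le_mono[of i "Suc i" m] by linarith
        then show ?thesis using False yM \<open>\<delta>' > 0\<close> by (simp add: c'_def)
      next
        case True
        show ?thesis
        proof (cases "Suc (i mod m) = m")
          case False
          then have "Suc i div m = i div m" "Suc i mod m = Suc (i mod m)"
            by (auto simp: div_Suc mod_Suc)
          then show ?thesis using True bd by (simp add: c'_def)
        next
          case eq: True
          then have e1: "Suc i div m = Suc (i div m)" "Suc i mod m = 0"
            by (auto simp: div_Suc mod_Suc)
          have "c' i = c (Suc (i div m))"
            using bk[of "i div m" "i mod m"] km[OF True] eq True by (simp add: c'_def)
          moreover have "c' (Suc i) = c (Suc (i div m))"
            using e1 b0 cn[of "Suc (i div m)"] by (simp add: c'_def)
          ultimately show ?thesis using cM \<open>\<delta>' > 0\<close> by simp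
        qed
      qed
    qed
  qed
qed

text \<open>
  The path is the uniform limit of step functions that run through successively refined chains at
  constant speed; the first chain lies in \<open>C\<close>. The jumps tend to zero, so the limit is continuous.
  Taking a small connected \<open>C\<close> gives short paths, and the whole space gives global ones.
\<close>
lemma path_near_connected:
  assumes cpt: "compact_space mtopology" and lc: "locally_connected_space mtopology"
    and C: "connectedin mtopology C" "x \<in> C" "y \<in> C" and "e > 0"
  obtains p where "continuous_map euclideanreal mtopology p" "p 0 = x" "p 1 = y"
    "\<And>t. \<exists>c\<in>C. d c (p t) < e"
proof -
  \<comment> \<open>\<open>E n\<close> bounds how far the \<open>n\<close>-th refinement moves points; these errors add up to \<open>e / 2\<close>.\<close>
  define E where "E n = e / 4 / 2 ^ n" for n :: nat
  have E0: "E n > 0" and ES: "E (Suc n) = E n / 2" for n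
    using \<open>e > 0\<close> by (auto simp: E_def)
  have "\<exists>\<delta>>0. \<delta> \<le> E n \<and> (\<forall>x\<in>M. \<forall>y\<in>M. d x y < \<delta> \<longrightarrow>
        (\<exists>C. connectedin mtopology C \<and> x \<in> C \<and> y \<in> C \<and> C \<subseteq> mball x (E n)))" for n
  proof -
    obtain \<delta> where "\<delta> > 0" "\<And>x y. \<lbrakk>x \<in> M; y \<in> M; d x y < \<delta>\<rbrakk>
       \<Longrightarrow> \<exists>C. connectedin mtopology C \<and> x \<in> C \<and> y \<in> C \<and> C \<subseteq> mball x (E n)"
      using uniformly_locally_connected[OF cpt lc E0[of n]] by metis
    then show ?thesis using E0[of n] by (intro exI[of _ "min \<delta> (E n)"]) auto
  qed
  then obtain \<delta> where d0: "\<And>n. \<delta> n > 0" and dE: "\<And>n. \<delta> n \<le> E n"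
    and ulc: "\<And>n x y. \<lbrakk>x \<in> M; y \<in> M; d x y < \<delta> n\<rbrakk>
       \<Longrightarrow> \<exists>C. connectedin mtopology C \<and> x \<in> C \<and> y \<in> C \<and> C \<subseteq> mball x (E n)"
    by metis
  have CM: "C \<subseteq> M" using C connectedin_subset_topspace by fastforce
  \<comment> \<open>A state \<open>s\<close> consists of the length of the current chain and of the chain itself.\<close>
  define P where "P n s \<longleftrightarrow> fst s \<ge> 1 \<and> is_chain (\<delta> n) (if n = 0 then C else M) x y (fst s) (snd s)"
    for n :: nat and s :: "nat \<times> (nat \<Rightarrow> 'a)"
  define Q where "Q n s s' \<longleftrightarrow> (\<exists>m\<ge>1. fst s' = fst s * m \<and> (\<forall>j. d (snd s (j div m)) (snd s' j) < E n))"
    for n :: nat and s s' :: "nat \<times> (nat \<Rightarrow> 'a)"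
  have "\<exists>s. \<forall>n. P n (s n) \<and> Q n (s n) (s (Suc n))"
  proof (rule dependent_nat_choice)
    obtain n c where "is_chain (\<delta> 0) C x y n c"
      using connected_imp_chain[OF C d0] by blast
    then have "P 0 (Suc n, c)" by (simp add: P_def is_chain_def)
    then show "\<exists>s. P 0 s" by blast
  next
    fix s n assume P: "P n s"
    then have chs: "is_chain (\<delta> n) M x y (fst s) (snd s)"
      using CM unfolding P_def is_chain_def by (auto split: if_splits)
    obtain m c where m: "m \<ge> 1" "is_chain (\<delta> (Suc n)) M x y (fst s * m) c"
        "\<forall>j. d (snd s (j div m)) (c j) < E n"
      by (rule chain_refine[OF ulc chs d0[of "Suc n"] E0]) blast
    then have "P (Suc n) (fst s * m, c) \<and> Q n s (fst s * m, c)"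
      using P by (auto simp: P_def Q_def)
    then show "\<exists>s'. P (Suc n) s' \<and> Q n s s'" by blast
  qed
  then obtain s where Ps: "\<And>n. P n (s n)" and Qs: "\<And>n. Q n (s n) (s (Suc n))" by blast
  define L where "L n = fst (s n)" for n
  define c where "c n = snd (s n)" for n
  have L1: "L n \<ge> 1" for n using Ps[of n] by (simp add: P_def L_def)
  have ch: "is_chain (\<delta> n) M x y (L n) (c n)" for n
    using Ps[of n] CM unfolding P_def is_chain_def L_def c_def by (auto split: if_splits)
  have chC: "c 0 i \<in> C" for i
    using Ps[of 0] by (simp add: P_def is_chain_def c_def)
  have cM: "c n i \<in> M" and cd: "d (c n i) (c n (Suc i)) < \<delta> n" for n i
    using ch[of n] unfolding is_chain_def by auto
  define cl where "cl t = max 0 (min 1 t)" for t :: real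
  define u where "u n t = c n (nat \<lfloor>real (L n) * cl t\<rfloor>)" for n t
  have uM: "u n t \<in> M" for n t by (simp add: u_def cM)
  have ustep: "d (u n t) (u (Suc n) t) < E n" for n t
  proof -
    obtain m where m: "m \<ge> 1" "L (Suc n) = L n * m" "\<And>j. d (c n (j div m)) (c (Suc n) j) < E n"
      using Qs[of n] unfolding Q_def L_def c_def by blast
    have "nat \<lfloor>real (L n) * cl t\<rfloor> = nat \<lfloor>real (L (Suc n)) * cl t\<rfloor> div m"
      unfolding m(2) using m(1) by (intro nat_floor_mult_div[symmetric]) (auto simp: cl_def)
    then show ?thesis using m(3) by (simp add: u_def)
  qed
  have ufar: "d (u n t) (u (n + k) t) \<le> 2 * E n - 2 * E (n + k)" for n k t
  proof (induction k)
    case 0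
    show ?case using uM by simp
  next
    case (Suc k)
    have "d (u n t) (u (n + Suc k) t) \<le> d (u n t) (u (n + k) t) + d (u (n + k) t) (u (Suc (n + k)) t)"
      using triangle[OF uM uM uM] by simp
    also have "\<dots> \<le> 2 * E n - 2 * E (n + k) + E (n + k)"
      using Suc ustep[of "n + k" t] by simp
    also have "\<dots> = 2 * E n - 2 * E (n + Suc k)" using ES[of "n + k"] by simp
    finally show ?case .
  qed
  have Elim: "E \<longlonglongrightarrow> 0"
    unfolding E_def using LIMSEQ_divide_realpow_zero[of 2 "e/4"] by simp
  have ufar': "d (u n t) (u k t) \<le> 2 * E n" if "n \<le> k" for n k t
    using ufar[of n t "k - n"] that E0[of k] by auto
  have "MCauchy (\<lambda>n. u n t)" for t
    unfolding MCauchy_def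
  proof (intro conjI allI impI)
    fix \<eta> :: real assume "\<eta> > 0"
    then obtain N where N: "E N < \<eta> / 4"
      using order_tendstoD(2)[OF Elim, of "\<eta>/4"] by (auto simp: eventually_sequentially)
    have "d (u n t) (u n' t) < \<eta>" if "N \<le> n" "N \<le> n'" for n n'
      using triangle[of "u n t" "u N t" "u n' t"] uM ufar'[OF that(1), of t] ufar'[OF that(2), of t] N
        commute[of "u n t" "u N t"] by simp
    then show "\<exists>N. \<forall>n n'. N \<le> n \<longrightarrow> N \<le> n' \<longrightarrow> d (u n t) (u n' t) < \<eta>" by blast
  qed (use uM in auto)
  then have "\<exists>l. limitin mtopology (\<lambda>n. u n t) l sequentially" for t
    using compact_space_imp_mcomplete[OF cpt] unfolding mcomplete_def by blast
  then obtain p where p: "\<And>t. limitin mtopology (\<lambda>n. u n t) (p t) sequentially" by metis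
  have pM: "p t \<in> M" for t using p[of t] limitin_mspace by blast
  have up: "d (u n t) (p t) \<le> 2 * E n" for n t
  proof (rule field_le_epsilon)
    fix \<eta> :: real assume "\<eta> > 0"
    then have "\<forall>\<^sub>F k in sequentially. d (u k t) (p t) < \<eta>"
      using p[of t] unfolding limitin_metric by (auto elim: eventually_mono)
    then obtain K where "\<And>k. k \<ge> K \<Longrightarrow> d (u k t) (p t) < \<eta>"
      unfolding eventually_sequentially by blast
    then have k: "max n K \<ge> n" "d (u (max n K) t) (p t) < \<eta>" by simp_all
    show "d (u n t) (p t) \<le> 2 * E n + \<eta>"
      using triangle[of "u n t" "u (max n K) t" "p t"] uM pM ufar'[OF k(1), of t] k(2) by simp
  qed
  have cont: "continuous_map euclideanreal mtopology p"
    unfolding continuous_map_to_metric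
  proof (intro ballI allI impI)
    fix t \<eta> :: real assume "\<eta> > 0"
    then obtain n where n: "E n < \<eta> / 5"
      using order_tendstoD(2)[OF Elim, of "\<eta>/5"] by (auto simp: eventually_sequentially)
    have "p z \<in> mball (p t) \<eta>" if z: "z \<in> ball t (1 / L n)" for z
    proof -
      have "\<bar>cl t - cl z\<bar> < 1 / L n" using z by (auto simp: cl_def dist_real_def)
      then have "real (L n) * \<bar>cl t - cl z\<bar> < 1"
        using L1[of n] by (simp add: field_simps)
      moreover have "real (L n) * cl t - real (L n) * cl z = real (L n) * (cl t - cl z)"
        by (simp add: algebra_simps)
      ultimately have close: "\<bar>real (L n) * cl t - real (L n) * cl z\<bar> < 1"
        by (simp add: abs_mult)
      have "d (u n t) (u n z) < \<delta> n"
        using nat_floor_close[OF close]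
      proof (elim disjE)
        assume "nat \<lfloor>real (L n) * cl t\<rfloor> = nat \<lfloor>real (L n) * cl z\<rfloor>"
        then show ?thesis using uM d0[of n] by (simp add: u_def)
      next
        assume "nat \<lfloor>real (L n) * cl t\<rfloor> = Suc (nat \<lfloor>real (L n) * cl z\<rfloor>)"
        then show ?thesis using cd[of n] by (simp add: u_def commute)
      next
        assume "nat \<lfloor>real (L n) * cl z\<rfloor> = Suc (nat \<lfloor>real (L n) * cl t\<rfloor>)"
        then show ?thesis using cd[of n] by (simp add: u_def)
      qed
      moreover have "d (p t) (p z) \<le> d (p t) (u n t) + (d (u n t) (u n z) + d (u n z) (p z))"
        using triangle[of "p t" "u n t" "p z"] triangle[of "u n t" "u n z" "p z"] uM pM by simp
      ultimately have "d (p t) (p z) < \<eta>"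
        using up[of n t] up[of n z] dE[of n] n commute[of "p t" "u n t"] by simp
      then show ?thesis using pM by simp
    qed
    then show "\<exists>U. openin euclideanreal U \<and> t \<in> U \<and> (\<forall>z\<in>U. p z \<in> mball (p t) \<eta>)"
      using L1[of n] by (intro exI[of _ "ball t (1 / L n)"]) auto
  qed
  have ends: "p 0 = x" "p 1 = y"
  proof -
    have "u n 0 = x" "u n 1 = y" for n
      using ch[of n] unfolding u_def is_chain_def cl_def by auto
    then have "limitin mtopology (\<lambda>n::nat. x) (p 0) sequentially"
        "limitin mtopology (\<lambda>n::nat. y) (p 1) sequentially"
      using p[of 0] p[of 1] by auto
    moreover have "limitin mtopology (\<lambda>n::nat. x) x sequentially" "limitin mtopology (\<lambda>n::nat. y) y sequentially"
      using C CM by auto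
    ultimately show "p 0 = x" "p 1 = y"
      using limitin_metric_unique trivial_limit_sequentially by metis+
  qed
  show thesis
  proof (rule that[OF cont ends])
    fix t
    have "u 0 t \<in> C" by (simp add: u_def chC)
    moreover have "d (u 0 t) (p t) < e" using up[of 0 t] \<open>e > 0\<close> by (simp add: E_def)
    ultimately show "\<exists>c\<in>C. d c (p t) < e" by blast
  qed
qed

lemma small_paths:
  assumes cpt: "compact_space mtopology" and lc: "locally_connected_space mtopology" and "e > 0"
  shows "\<exists>\<delta>>0. \<forall>x\<in>M. \<forall>y\<in>M. d x y < \<delta> \<longrightarrow>
    (\<exists>p. continuous_map euclideanreal mtopology p \<and> p 0 = x \<and> p 1 = y \<and> (\<forall>t. p t \<in> mball x e))"
proof -
  have e2: "e / 2 > 0" using \<open>e > 0\<close> by simp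
  show ?thesis
  proof (rule uniformly_locally_connected[OF cpt lc e2])
    fix \<delta> :: real assume \<delta>: "\<delta> > 0" and ulc: "\<And>x y. \<lbrakk>x \<in> M; y \<in> M; d x y < \<delta>\<rbrakk>
       \<Longrightarrow> \<exists>C. connectedin mtopology C \<and> x \<in> C \<and> y \<in> C \<and> C \<subseteq> mball x (e/2)"
    have "\<exists>p. continuous_map euclideanreal mtopology p \<and> p 0 = x \<and> p 1 = y \<and> (\<forall>t. p t \<in> mball x e)"
      if xy: "x \<in> M" "y \<in> M" "d x y < \<delta>" for x y
    proof -
      obtain C where C: "connectedin mtopology C" "x \<in> C" "y \<in> C" "C \<subseteq> mball x (e/2)"
        using ulc[OF xy] by blast
      show ?thesis
      proof (rule path_near_connected[OF cpt lc C(1-3) e2])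
        fix p assume p: "continuous_map euclideanreal mtopology p" "p 0 = x" "p 1 = y"
          "\<And>t. \<exists>c\<in>C. d c (p t) < e/2"
        have pM: "p t \<in> M" for t using p(1) by (auto simp: continuous_map_def)
        have "p t \<in> mball x e" for t
        proof -
          obtain c where "c \<in> C" "d c (p t) < e/2" using p(4) by blast
          moreover from this have "c \<in> mball x (e/2)" using C by blast
          ultimately show ?thesis using triangle[of x c "p t"] pM by auto
        qed
        then show ?thesis using p by blast
      qed
    qed
    then show ?thesis using \<delta> by blast
  qed
qed

text \<open>
  A connected space with more than one point has no isolated points, so there is a second point
  close to \<open>x\<close>, and a short path to it.
\<close>
lemma small_nonconstant_path:
  assumes cpt: "compact_space mtopology" and lc: "locally_connected_space mtopology"
    and con: "connected_space mtopology" and nt: "M \<noteq> {x}" and "e > 0" and x: "x \<in> M"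
  shows "\<exists>p. continuous_map euclideanreal mtopology p \<and> (\<forall>t. p t \<in> mball x e) \<and>
     (\<exists>t\<in>{0..1}. \<exists>t'\<in>{0..1}. p t \<noteq> p t')"
proof -
  obtain \<delta> where \<delta>: "\<delta> > 0" "\<forall>x\<in>M. \<forall>y\<in>M. d x y < \<delta> \<longrightarrow>
    (\<exists>p. continuous_map euclideanreal mtopology p \<and> p 0 = x \<and> p 1 = y \<and> (\<forall>t. p t \<in> mball x e))"
    using small_paths[OF cpt lc \<open>e > 0\<close>] by blast
  have "\<exists>y\<in>M. y \<noteq> x \<and> d x y < \<delta>"
  proof (rule ccontr)
    assume "\<not> ?thesis"
    then have "mball x \<delta> = {x}" using x \<delta> by auto
    then have "openin mtopology {x}" using openin_mball by metis
    moreover have "closedin mtopology {x}"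
      using x Hausdorff_space_mtopology by (simp add: closedin_Hausdorff_sing_eq)
    ultimately have "{x} = M" using con unfolding connected_space_clopen_in by force
    then show False using nt by simp
  qed
  then obtain y where y: "y \<in> M" "y \<noteq> x" "d x y < \<delta>" by blast
  then obtain p where p: "continuous_map euclideanreal mtopology p" "p 0 = x" "p 1 = y" "\<forall>t. p t \<in> mball x e"
    using \<delta>(2) x by blast
  then have "\<exists>t\<in>{0..1}. \<exists>t'\<in>{0..1}. p t \<noteq> p t'"
    using y by (intro bexI[of _ 0] bexI[of _ 1]) auto
  then show ?thesis using p by blast
qed

end

section \<open>One-dimensional spaces as unions of two disjoint families of small sets\<close>

context Metric_space
begin

text \<open>
  The witness is the distance to the complement of \<open>U\<close>, truncated at 1 so that it also makes sense for
  an empty complement.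
\<close>
lemma open_is_cozero:
  assumes U: "openin mtopology U"
  shows "\<exists>w. continuous_map mtopology euclideanreal w \<and> (\<forall>x\<in>M. w x \<ge> (0::real) \<and> (w x > 0 \<longleftrightarrow> x \<in> U))"
proof -
  define w where "w x = Inf (insert 1 (d x ` (M - U)))" for x
  have bdd: "bdd_below (insert 1 (d x ` (M - U)))" for x
    by (rule bdd_belowI[of _ 0]) auto
  have w0: "w x \<ge> 0" for x unfolding w_def by (rule cInf_greatest) auto
  have w1: "w x \<le> 1" for x unfolding w_def by (rule cInf_lower[OF _ bdd]) auto
  have wd: "w x \<le> d x z" if "z \<in> M - U" for x z
    unfolding w_def by (rule cInf_lower[OF _ bdd]) (use that in auto)
  have lip: "w x - d x y \<le> w y" if "x \<in> M" "y \<in> M" for x y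
    unfolding w_def[of y]
  proof (rule cInf_greatest)
    fix s assume "s \<in> insert 1 (d y ` (M - U))"
    then consider "s = 1" | z where "z \<in> M - U" "s = d y z" by auto
    then show "w x - d x y \<le> s"
    proof cases
      case 1
      then show ?thesis using w1[of x] nonneg[of x y] by linarith
    next
      case 2
      then show ?thesis using wd[of z x] triangle[of x y z] that by auto
    qed
  qed auto
  have "continuous_map mtopology Met_TC.mtopology w"
    unfolding Met_TC.continuous_map_to_metric
  proof (intro ballI allI impI)
    fix x and e :: real assume x: "x \<in> topspace mtopology" and e: "e > 0"
    have "w y \<in> Met_TC.mball (w x) e" if "y \<in> mball x e" for y
      using lip[of x y] lip[of y x] that commute[of x y] by (auto simp: dist_real_def)
    then show "\<exists>U. openin mtopology U \<and> x \<in> U \<and> (\<forall>y\<in>U. w y \<in> Met_TC.mball (w x) e)"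
      using x e by (intro exI[of _ "mball x e"]) auto
  qed
  then have cont: "continuous_map mtopology euclideanreal w" by simp
  have pos: "w x > 0 \<longleftrightarrow> x \<in> U" if "x \<in> M" for x
  proof
    assume "w x > 0"
    then show "x \<in> U" using wd[of x x] that by (cases "x \<in> U") auto
  next
    assume "x \<in> U"
    then obtain r where r: "r > 0" "mball x r \<subseteq> U" using U openin_mtopology by meson
    have "min 1 r \<le> w x" unfolding w_def
    proof (rule cInf_greatest)
      fix s assume "s \<in> insert 1 (d x ` (M - U))"
      then consider "s = 1" | z where "z \<in> M - U" "s = d x z" by auto
      then show "min 1 r \<le> s"
      proof cases
        case 2
        then have "z \<notin> mball x r" using r by blast
        then show ?thesis using 2 that by auto
      qed auto
    qed auto
    then show "w x > 0" using r by linarith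
  qed
  show ?thesis using cont w0 pos by blast
qed

definition small :: "real \<Rightarrow> 'a set \<Rightarrow> bool" where
  "small e A \<longleftrightarrow> (\<forall>a\<in>A. \<forall>b\<in>A. d a b < e)"

text \<open>
  The empty set is put into the family as the piece assigned to points that lie in no other member.
\<close>
definition small_pieces :: "real \<Rightarrow> 'a set set \<Rightarrow> bool" where
  "small_pieces e \<A> \<longleftrightarrow> finite \<A> \<and> {} \<in> \<A> \<and> pairwise disjnt \<A> \<and> (\<forall>A\<in>\<A>. openin mtopology A \<and> small e A)"

text \<open>
  In an open cover \<open>\<V>\<close> of order one, with functions \<open>w V\<close> positive exactly on \<open>V\<close>, at most two of the
  numbers \<open>w V x\<close> are nonzero. The sets on which \<open>w V\<close> is the strict maximum are pairwise disjoint, and so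
  are the intersections of two different members of \<open>\<V>\<close>. If \<open>a\<close> and \<open>b\<close> are the two largest of the
  numbers at \<open>x\<close>, then \<open>\<theta> x = 4ab / (a + b)\<^sup>2\<close> is less than 1 iff the maximum is strict, and positive iff \<open>x\<close>
  lies in two members. In the nerve of the cover, \<open>\<theta> = 0\<close> describes the vertices and \<open>\<theta> = 1\<close> the midpoints
  of the edges.
\<close>
lemma dim_1_two_families:
  assumes cpt: "compact_space mtopology" and dim: "covering_dim_le mtopology 1" and "e > 0"
  obtains \<theta> \<A> \<B> where "continuous_map mtopology euclideanreal \<theta>"
    "\<forall>x\<in>M. 0 \<le> \<theta> x \<and> \<theta> x \<le> (1::real)"
    "small_pieces e \<A>" "\<Union>\<A> = {x \<in> M. \<theta> x < 1}"
    "small_pieces e \<B>" "\<Union>\<B> = {x \<in> M. \<theta> x > 0}"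
proof -
  have "\<forall>U\<in>(\<lambda>x. mball x (e/2)) ` M. openin mtopology U" "M \<subseteq> \<Union>((\<lambda>x. mball x (e/2)) ` M)"
    using \<open>e > 0\<close> by auto
  then obtain \<U> where \<U>: "finite \<U>" "\<U> \<subseteq> (\<lambda>x. mball x (e/2)) ` M" "M \<subseteq> \<Union>\<U>"
    using cpt unfolding compact_space_alt topspace_mtopology by meson
  have "\<forall>U\<in>\<U>. openin mtopology U" using \<U> by auto
  moreover have "\<Union>\<U> = topspace mtopology" using \<U> by auto
  ultimately have "\<exists>\<V>. finite \<V> \<and> (\<forall>V\<in>\<V>. openin mtopology V) \<and> \<Union>\<V> = M \<and>
      (\<forall>V\<in>\<V>. \<exists>U\<in>\<U>. V \<subseteq> U) \<and> (\<forall>x\<in>M. card {V\<in>\<V>. x \<in> V} \<le> 2)"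
    using dim[unfolded covering_dim_le_def, rule_format, of \<U>] \<U>(1)
    by (simp add: numeral_2_eq_2)
  then obtain \<V> where \<V>: "finite \<V>" "\<forall>V\<in>\<V>. openin mtopology V" "\<Union>\<V> = M"
      "\<forall>V\<in>\<V>. \<exists>U\<in>\<U>. V \<subseteq> U" "\<forall>x\<in>M. card {V\<in>\<V>. x \<in> V} \<le> 2"
    by (elim exE conjE) (rule that)
  have smallV: "small e V" if V: "V \<in> \<V>" for V
  proof -
    obtain x where x: "V \<subseteq> mball x (e/2)" using \<V>(4) \<U>(2) V by blast
    have "d a b < e" if "a \<in> V" "b \<in> V" for a b
    proof -
      have "a \<in> mball x (e/2)" "b \<in> mball x (e/2)" using x that by auto
      then show ?thesis using triangle[of a x b] commute[of a x] by auto
    qed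
    then show ?thesis by (simp add: small_def)
  qed
  have "\<exists>w. continuous_map mtopology euclideanreal w \<and> (\<forall>x\<in>M. w x \<ge> (0::real) \<and> (w x > 0 \<longleftrightarrow> x \<in> V))"
    if "V \<in> \<V>" for V
    using open_is_cozero[of V] \<V>(2) that by blast
  then obtain w where wc: "\<And>V. V \<in> \<V> \<Longrightarrow> continuous_map mtopology euclideanreal (w V)"
    and w0: "\<And>V x. V \<in> \<V> \<Longrightarrow> x \<in> M \<Longrightarrow> w V x \<ge> (0::real)"
    and wpos: "\<And>V x. V \<in> \<V> \<Longrightarrow> x \<in> M \<Longrightarrow> w V x > 0 \<longleftrightarrow> x \<in> V" by metis
  define S where "S x = (\<Sum>V\<in>\<V>. w V x)" for x
  define T where "T x = (\<Sum>V\<in>\<V>. (w V x)\<^sup>2)" for x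
  \<comment> \<open>With values \<open>a\<close>, \<open>b\<close> and all others zero, \<open>S\<^sup>2 - T = 2ab\<close>; so \<open>\<theta>\<close> is \<open>4ab / (a + b)\<^sup>2\<close>, and its
    continuity is evident from this form.\<close>
  define \<theta> where "\<theta> x = 2 * (S x ^ 2 - T x) / S x ^ 2" for x
  define At where "At V = {x \<in> M. \<forall>U\<in>\<V> - {V}. w U x < w V x}" for V
  define \<A> where "\<A> = insert {} (At ` \<V>)"
  define \<B> where "\<B> = insert {} ((\<lambda>(V,W). V \<inter> W) ` {(V,W). V \<in> \<V> \<and> W \<in> \<V> \<and> V \<noteq> W})"
  have one_or_two: "(\<exists>V\<in>\<V>. {V\<in>\<V>. x \<in> V} = {V}) \<or>
      (\<exists>V\<in>\<V>. \<exists>W\<in>\<V>. V \<noteq> W \<and> w W x \<le> w V x \<and> {V\<in>\<V>. x \<in> V} = {V, W})" if x: "x \<in> M" for x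
  proof -
    let ?N = "{V\<in>\<V>. x \<in> V}"
    have "finite ?N" "?N \<noteq> {}" "card ?N \<le> 2" using \<V> x by auto
    then have "card ?N = 1 \<or> card ?N = 2" 
      by (metis One_nat_def Suc_1 card_gt_0_iff le_Suc_eq le_zero_eq less_numeral_extra(3))
    then show ?thesis
    proof
      assume "card ?N = 1"
      then show ?thesis by (metis (no_types, lifting) card_1_singletonE mem_Collect_eq singletonI)
    next
      assume "card ?N = 2"
      then obtain V W where VW: "?N = {V, W}" "V \<noteq> W" by (meson card_2_iff)
      then have "V \<in> \<V>" "W \<in> \<V>" by auto
      then show ?thesis using VW linear[of "w V x" "w W x"] by (metis insert_commute)
    qed
  qed
  have sum_nbhd: "sum f \<V> = sum f {V\<in>\<V>. x \<in> V}" 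
    if "x \<in> M" "\<And>V. V \<in> \<V> \<Longrightarrow> x \<notin> V \<Longrightarrow> f V = 0" for x and f :: "'a set \<Rightarrow> real"
    using that \<V>(1) by (intro sum.mono_neutral_right) auto
  have wzero: "w V x = 0" if "V \<in> \<V>" "x \<in> M" "x \<notin> V" for V x
    using w0[OF that(1,2)] wpos[OF that(1,2)] that(3) by auto
  have eval: "x \<in> M \<Longrightarrow> S x = sum (\<lambda>V. w V x) {V\<in>\<V>. x \<in> V}"
     "x \<in> M \<Longrightarrow> T x = sum (\<lambda>V. (w V x)^2) {V\<in>\<V>. x \<in> V}" for x
    unfolding S_def T_def by (intro sum_nbhd; simp add: wzero)+
  have alt: "0 < S x \<and> ((\<exists>V\<in>\<V>. \<theta> x = 0 \<and> x \<in> At V \<and> {V\<in>\<V>. x \<in> V} = {V}) \<or>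
      (\<exists>V\<in>\<V>. \<exists>W\<in>\<V>. V \<noteq> W \<and> x \<in> V \<inter> W \<and> 0 < \<theta> x \<and> \<theta> x \<le> 1 \<and> (\<theta> x = 1 \<longleftrightarrow> w V x = w W x) \<and> 
         (w V x \<noteq> w W x \<longrightarrow> x \<in> At V)))" if x: "x \<in> M" for x
    using one_or_two[OF x]
  proof
    assume "\<exists>V\<in>\<V>. {V\<in>\<V>. x \<in> V} = {V}"
    then obtain V where V: "V \<in> \<V>" "{V\<in>\<V>. x \<in> V} = {V}" by blast
    then have xV: "x \<in> V" by blast
    have other: "w U x = 0" if "U \<in> \<V>" "U \<noteq> V" for U
      using V(2) that by (intro wzero[OF _ x]) auto
    have "w V x > 0" using wpos[OF V(1) x] xV by simp
    moreover have "S x = w V x" "T x = (w V x)^2" using eval[OF x] V(2) by auto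
    moreover have "x \<in> At V" using other calculation(1) x by (simp add: At_def)
    ultimately show ?thesis using V by (auto simp: \<theta>_def)
  next
    assume "\<exists>V\<in>\<V>. \<exists>W\<in>\<V>. V \<noteq> W \<and> w W x \<le> w V x \<and> {V\<in>\<V>. x \<in> V} = {V, W}"
    then obtain V W where V: "V \<in> \<V>" "W \<in> \<V>" "V \<noteq> W" "w W x \<le> w V x" "{V\<in>\<V>. x \<in> V} = {V, W}"
      by blast
    then have xV: "x \<in> V" "x \<in> W" by blast+
    have other: "w U x = 0" if "U \<in> \<V>" "U \<noteq> V" "U \<noteq> W" for U
      using V(5) that by (intro wzero[OF _ x]) auto
    have pos: "w V x > 0" "w W x > 0" using wpos[OF V(1) x] wpos[OF V(2) x] xV by simp_all
    have ST: "S x = w V x + w W x" "T x = (w V x)^2 + (w W x)^2" using eval[OF x] V(3,5) by auto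
    have "S x > 0" using ST pos by simp
    have th: "\<theta> x = 4 * (w V x * w W x) / S x ^ 2"
      by (simp add: \<theta>_def ST power2_eq_square algebra_simps)
    have th1: "1 - \<theta> x = ((w V x - w W x) / S x) ^ 2"
      using \<open>S x > 0\<close> unfolding th by (simp add: field_simps) (simp add: ST power2_eq_square algebra_simps)
    have "\<theta> x > 0" unfolding th using pos \<open>S x > 0\<close> by simp
    moreover have "\<theta> x \<le> 1" using th1 by (metis diff_ge_0_iff_ge zero_le_power2)
    moreover have "\<theta> x = 1 \<longleftrightarrow> w V x = w W x" 
    proof -
      have "\<theta> x = 1 \<longleftrightarrow> ((w V x - w W x) / S x) ^ 2 = 0" using th1 by linarith
      then show ?thesis using \<open>S x > 0\<close> by simp
    qed
    moreover have "x \<in> At V" if "w V x \<noteq> w W x"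
      using other that V x pos unfolding At_def by (smt (verit, best) Diff_iff mem_Collect_eq singleton_iff)
    ultimately show ?thesis using V xV \<open>S x > 0\<close> by blast
  qed
  have At_sub: "x \<in> V" if "x \<in> At V" "V \<in> \<V>" for x V
  proof -
    have x: "x \<in> M" using that by (simp add: At_def)
    then obtain U where U: "U \<in> \<V>" "x \<in> U" using \<V> by blast
    show ?thesis
    proof (cases "U = V")
      case False
      then have "w U x < w V x" using that U by (simp add: At_def)
      then show ?thesis using wpos[OF that(2) x] w0[OF U(1) x] by simp
    qed (use U in simp)
  qed
  have At_open: "openin mtopology (At V)" if "V \<in> \<V>" for V
  proof -
    have "openin mtopology {x \<in> topspace mtopology. w V x - w U x \<in> {0<..}}" if "U \<in> \<V>" for U
      using that \<open>V \<in> \<V>\<close> wc by (intro openin_continuous_map_preimage[where Y = euclideanreal] continuous_map_diff) auto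
    then have "openin mtopology ((\<Inter>U\<in>\<V> - {V}. {x \<in> topspace mtopology. w V x - w U x \<in> {0<..}}) \<inter> topspace mtopology)"
      using \<V>(1) by (intro openin_INT) auto
    also have "((\<Inter>U\<in>\<V> - {V}. {x \<in> topspace mtopology. w V x - w U x \<in> {0<..}}) \<inter> topspace mtopology) = At V"
      by (auto simp: At_def)
    finally show ?thesis .
  qed
  have S0: "S x \<noteq> 0" if "x \<in> M" for x using alt[OF that] by auto
  show thesis
  proof
    have "continuous_map mtopology euclideanreal S"
      unfolding S_def by (rule continuous_map_sum[OF \<V>(1) wc])
    moreover have "continuous_map mtopology euclideanreal T"
      unfolding T_def by (rule continuous_map_sum[OF \<V>(1) continuous_map_real_pow[OF wc]])
    ultimately show "continuous_map mtopology euclideanreal \<theta>"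
      unfolding \<theta>_def
      by (intro continuous_map_real_divide continuous_map_real_mult_left continuous_map_diff
          continuous_map_real_pow) (use S0 in auto)
    have "0 \<le> \<theta> x \<and> \<theta> x \<le> 1" if "x \<in> M" for x
      using alt[OF that] by (elim conjE disjE bexE) simp_all
    then show "\<forall>x\<in>M. 0 \<le> \<theta> x \<and> \<theta> x \<le> 1" by blast
    show "small_pieces e \<A>"
      unfolding small_pieces_def
    proof (intro conjI ballI)
      show "pairwise disjnt \<A>"
        unfolding \<A>_def pairwise_insert
      proof (intro conjI allI impI)
        show "pairwise disjnt (At ` \<V>)"
        proof (rule pairwiseI)
          fix A B assume "A \<in> At ` \<V>" "B \<in> At ` \<V>" "A \<noteq> B"
          then obtain V W where VW: "V \<in> \<V>" "W \<in> \<V>" "A = At V" "B = At W" "V \<noteq> W" by blast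
          have False if "x \<in> A" "x \<in> B" for x
          proof -
            have "w W x < w V x" "w V x < w W x" using that VW by (auto simp: At_def)
            then show False by simp
          qed
          then show "disjnt A B" unfolding disjnt_iff by blast
        qed
      qed auto
      show "small e A" if "A \<in> \<A>" for A
        using that smallV At_sub unfolding \<A>_def small_def by blast
      show "openin mtopology A" if "A \<in> \<A>" for A
        using that At_open unfolding \<A>_def by auto
    qed (use \<V>(1) in \<open>auto simp: \<A>_def\<close>)
    show "\<Union>\<A> = {x \<in> M. \<theta> x < 1}"
    proof (intro subset_antisym subsetI)
      fix x assume "x \<in> \<Union>\<A>"
      then obtain U where U: "U \<in> \<V>" "x \<in> At U" by (auto simp: \<A>_def)
      then have x: "x \<in> M" by (simp add: At_def)
      have "\<theta> x < 1"
        using alt[OF x]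
      proof (elim conjE disjE bexE)
        fix V W assume V: "V \<in> \<V>" "W \<in> \<V>" "V \<noteq> W" "\<theta> x \<le> 1" "\<theta> x = 1 \<longleftrightarrow> w V x = w W x" "x \<in> V \<inter> W"
        have pos: "w V x > 0" "w W x > 0" using wpos[OF V(1) x] wpos[OF V(2) x] V by simp_all
        have "w V x \<noteq> w W x"
        proof
          assume eq: "w V x = w W x"
          show False
          proof (cases "U = V")
            case True
            then have "w W x < w V x" using U V by (simp add: At_def)
            with eq show False by simp
          next
            case False
            then have UV: "w V x < w U x" using U V by (simp add: At_def)
            then have "U \<noteq> W" using eq by auto
            have "x \<in> U" using At_sub U by blast
            then have "{U, V, W} \<subseteq> {V\<in>\<V>. x \<in> V}" using U V by blast
            then have "card {U, V, W} \<le> card {V\<in>\<V>. x \<in> V}"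
              by (rule card_mono[rotated]) (use \<V>(1) in simp)
            also have "\<dots> \<le> 2" using \<V>(5) x by blast
            finally have "card {U, V, W} \<le> 2" .
            then show False using False \<open>U \<noteq> W\<close> V by simp
          qed
        qed
        then show ?thesis using V by linarith
      qed simp
      then show "x \<in> {x \<in> M. \<theta> x < 1}" using x by simp
    next
      fix x assume "x \<in> {x \<in> M. \<theta> x < 1}"
      then have x: "x \<in> M" "\<theta> x \<noteq> 1" by auto
      then show "x \<in> \<Union>\<A>" using alt[OF x(1)] unfolding \<A>_def by blast
    qed
    have B_eq: "V \<inter> W = V' \<inter> W'" if "V \<in> \<V>" "W \<in> \<V>" "V \<noteq> W" "V' \<in> \<V>" "W' \<in> \<V>" "V' \<noteq> W'" 
      "x \<in> V \<inter> W" "x \<in> V' \<inter> W'" for V W V' W' x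
    proof -
      have x: "x \<in> M" using that \<V> by blast
      have N: "finite {V\<in>\<V>. x \<in> V}" "card {V\<in>\<V>. x \<in> V} \<le> 2" using \<V> x by auto
      have "{V,W} = {V\<in>\<V>. x \<in> V}" using that N by (intro card_seteq) auto
      moreover have "{V',W'} = {V\<in>\<V>. x \<in> V}" using that N by (intro card_seteq) auto
      ultimately have "\<Inter>{V,W} = \<Inter>{V',W'}" by simp
      then show ?thesis by simp
    qed
    show "small_pieces e \<B>"
      unfolding small_pieces_def
    proof (intro conjI ballI)
      show "pairwise disjnt \<B>"
        unfolding \<B>_def pairwise_insert
      proof (intro conjI allI impI pairwiseI)
        fix A B assume "A \<in> (\<lambda>(V,W). V \<inter> W) ` {(V,W). V \<in> \<V> \<and> W \<in> \<V> \<and> V \<noteq> W}"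
          "B \<in> (\<lambda>(V,W). V \<inter> W) ` {(V,W). V \<in> \<V> \<and> W \<in> \<V> \<and> V \<noteq> W}" "A \<noteq> B"
        then show "disjnt A B" unfolding disjnt_iff using B_eq by blast
      qed auto
      show "small e A" if "A \<in> \<B>" for A
        using that smallV unfolding \<B>_def small_def by blast
      show "openin mtopology A" if "A \<in> \<B>" for A
        using that \<V>(2) unfolding \<B>_def by auto
      have "finite (\<V> \<times> \<V>)" using \<V>(1) by simp
      then have "finite {(V,W). V \<in> \<V> \<and> W \<in> \<V> \<and> V \<noteq> W}" by (rule rev_finite_subset) auto
      then show "finite \<B>" by (simp add: \<B>_def)
    qed (auto simp: \<B>_def)
    show "\<Union>\<B> = {x \<in> M. \<theta> x > 0}"
    proof (intro subset_antisym subsetI)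
      fix x assume "x \<in> \<Union>\<B>"
      then obtain V W where V: "V \<in> \<V>" "W \<in> \<V>" "V \<noteq> W" "x \<in> V" "x \<in> W" by (auto simp: \<B>_def)
      then have x: "x \<in> M" using \<V> by blast
      have N: "{V\<in>\<V>. x \<in> V} \<noteq> {U}" for U
      proof
        assume "{V\<in>\<V>. x \<in> V} = {U}"
        moreover have "V \<in> {V\<in>\<V>. x \<in> V}" "W \<in> {V\<in>\<V>. x \<in> V}" using V by simp_all
        ultimately show False using \<open>V \<noteq> W\<close> by simp
      qed
      have "\<theta> x > 0" using alt[OF x]
      proof (elim conjE disjE bexE)
        fix V assume "{V\<in>\<V>. x \<in> V} = {V}"
        with N show ?thesis by blast
      qed simp
      then show "x \<in> {x \<in> M. \<theta> x > 0}" using x by simp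
    next
      fix x assume "x \<in> {x \<in> M. \<theta> x > 0}"
      then have x: "x \<in> M" "\<theta> x \<noteq> 0" by auto
      then obtain V W where "V \<in> \<V>" "W \<in> \<V>" "V \<noteq> W" "x \<in> V \<inter> W" using alt[OF x(1)] by blast
      then show "x \<in> \<Union>\<B>" unfolding \<B>_def by blast
    qed
  qed
qed

text \<open>
  A piece need not be closed, but its limit points outside it belong to no other piece either.
\<close>
lemma small_pieces_closed_complement:
  assumes "small_pieces e \<A>" "A \<in> \<A>"
  shows "closedin mtopology (M - \<Union>(\<A> - {A}))" "A \<subseteq> M - \<Union>(\<A> - {A})"
proof -
  have "openin mtopology (\<Union>(\<A> - {A}))"
    using assms by (intro openin_Union) (auto simp: small_pieces_def)
  then show "closedin mtopology (M - \<Union>(\<A> - {A}))"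
    by (metis closedin_diff closedin_topspace topspace_mtopology)
  have "A \<subseteq> M" using assms openin_subset unfolding small_pieces_def by fastforce
  moreover have "A \<inter> \<Union>(\<A> - {A}) = {}"
    using assms by (fastforce simp: small_pieces_def pairwise_def disjnt_def)
  ultimately show "A \<subseteq> M - \<Union>(\<A> - {A})" by blast
qed

text \<open>
  A point with \<open>\<theta> x < t\<close> has \<open>\<theta> x < 1\<close> and lies in a piece of the first family; the part of this piece on
  which \<open>\<theta> < t\<close> can only be left through the level \<open>\<theta> = t\<close>. Points with \<open>\<theta> x > t\<close> are treated in the same way with
  the second family.
\<close>
lemma dim_1_separating_function:
  assumes cpt: "compact_space mtopology" and dim: "covering_dim_le mtopology 1" and "e > 0"
  shows "\<exists>\<theta>. continuous_map mtopology euclideanreal \<theta> \<and> (\<forall>x\<in>M. \<theta> x \<in> {0..1}) \<and>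
    (\<forall>t\<in>{0..1}. \<forall>x\<in>M. \<theta> x \<noteq> t \<longrightarrow>
      (\<exists>U. openin mtopology U \<and> x \<in> U \<and> small e U \<and> mtopology closure_of U \<subseteq> U \<union> {z. \<theta> z = t}))"
proof -
  obtain \<theta> \<A> \<B> where c: "continuous_map mtopology euclideanreal \<theta>"
    and th: "\<forall>x\<in>M. 0 \<le> \<theta> x \<and> \<theta> x \<le> (1::real)"
    and A: "small_pieces e \<A>" "\<Union>\<A> = {x \<in> M. \<theta> x < 1}"
    and B: "small_pieces e \<B>" "\<Union>\<B> = {x \<in> M. \<theta> x > 0}"
    by (rule dim_1_two_families[OF assms]) blast
  have "\<exists>U. openin mtopology U \<and> x \<in> U \<and> small e U \<and> mtopology closure_of U \<subseteq> U \<union> {z. \<theta> z = t}"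
    if t: "t \<in> {0..1}" and x: "x \<in> M" and ne: "\<theta> x \<noteq> t" for t x
  proof (cases "\<theta> x < t")
    case True
    then have "x \<in> \<Union>\<A>" using A(2) x t by auto
    then obtain C where C: "C \<in> \<A>" "x \<in> C" by blast
    let ?U = "C \<inter> {z \<in> topspace mtopology. \<theta> z \<in> {..<t}}"
    let ?F = "(M - \<Union>(\<A> - {C})) \<inter> {z \<in> topspace mtopology. \<theta> z \<in> {..t}}"
    have "openin mtopology ?U"
      using A(1) C openin_continuous_map_preimage[OF c, of "{..<t}"] by (auto simp: small_pieces_def)
    moreover have "x \<in> ?U" using C True x by auto
    moreover have "small e ?U" using A(1) C by (auto simp: small_pieces_def small_def)
    moreover have "mtopology closure_of ?U \<subseteq> ?F"
    proof (rule closure_of_minimal)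
      show "?U \<subseteq> ?F" using small_pieces_closed_complement(2)[OF A(1) C(1)] by auto
      show "closedin mtopology ?F"
        using small_pieces_closed_complement(1)[OF A(1) C(1)] closedin_continuous_map_preimage[OF c, of "{..t}"]
        by (intro closedin_Int) auto
    qed
    moreover have "?F \<subseteq> ?U \<union> {z. \<theta> z = t}"
    proof
      fix z assume z: "z \<in> ?F"
      show "z \<in> ?U \<union> {z. \<theta> z = t}"
      proof (cases "\<theta> z = t")
        case False
        then have "z \<in> M" "\<theta> z < t" using z by auto
        then have "z \<in> \<Union>\<A>" using A(2) t by auto
        then show ?thesis using z \<open>\<theta> z < t\<close> by auto
      qed simp
    qed
    ultimately show ?thesis by (meson order_trans)
  next
    case False
    then have tx: "t < \<theta> x" using ne by simp
    then have "x \<in> \<Union>\<B>" using B(2) x t by auto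
    then obtain C where C: "C \<in> \<B>" "x \<in> C" by blast
    let ?U = "C \<inter> {z \<in> topspace mtopology. \<theta> z \<in> {t<..}}"
    let ?F = "(M - \<Union>(\<B> - {C})) \<inter> {z \<in> topspace mtopology. \<theta> z \<in> {t..}}"
    have "openin mtopology ?U"
      using B(1) C openin_continuous_map_preimage[OF c, of "{t<..}"] by (auto simp: small_pieces_def)
    moreover have "x \<in> ?U" using C tx x by auto
    moreover have "small e ?U" using B(1) C by (auto simp: small_pieces_def small_def)
    moreover have "mtopology closure_of ?U \<subseteq> ?F"
    proof (rule closure_of_minimal)
      show "?U \<subseteq> ?F" using small_pieces_closed_complement(2)[OF B(1) C(1)] by auto
      show "closedin mtopology ?F"
        using small_pieces_closed_complement(1)[OF B(1) C(1)] closedin_continuous_map_preimage[OF c, of "{t..}"]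
        by (intro closedin_Int) auto
    qed
    moreover have "?F \<subseteq> ?U \<union> {z. \<theta> z = t}"
    proof
      fix z assume z: "z \<in> ?F"
      show "z \<in> ?U \<union> {z. \<theta> z = t}"
      proof (cases "\<theta> z = t")
        case False
        then have "z \<in> M" "t < \<theta> z" using z by auto
        then have "z \<in> \<Union>\<B>" using B(2) t by auto
        then show ?thesis using z \<open>t < \<theta> z\<close> by auto
      qed simp
    qed
    ultimately show ?thesis by (meson order_trans)
  qed
  then show ?thesis using c th by (intro exI[of _ \<theta>]) auto
qed

end

section \<open>Moving all points of a curve along nonconstant paths\<close>

definition clamp01 :: "real \<Rightarrow> real" where "clamp01 t = max 0 (min 1 t)"

lemma clamp01_in [simp]: "clamp01 t \<in> {0..1}" "0 \<le> clamp01 t" "clamp01 t \<le> 1"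
  by (auto simp: clamp01_def)

lemma clamp01_id [simp]: "t \<in> {0..1} \<Longrightarrow> clamp01 t = t"
  by (auto simp: clamp01_def)

lemma continuous_map_clamp01: "continuous_map euclideanreal euclideanreal clamp01"
  unfolding clamp01_def continuous_map_iff_continuous by (intro continuous_intros)

text \<open>
  Let \<open>R\<close> be the concatenation of \<open>P\<close>, \<open>\<gamma>\<close> and \<open>Q\<close>, defined on \<open>[0,3]\<close>. The path \<open>K (s, \<cdot>)\<close> is \<open>R\<close> restricted to a
  window that first grows from \<open>[0,1]\<close> to \<open>[0,3]\<close> and then shrinks to \<open>[2,3]\<close>. Every window contains
  \<open>[0,1]\<close> or \<open>[2,3]\<close>, so no path on the way is constant.
\<close>
lemma nonconstant_path_homotopy:
  fixes P \<gamma> Q :: "real \<Rightarrow> 'a"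
  assumes P: "continuous_map euclideanreal X P" and \<gamma>: "continuous_map euclideanreal X \<gamma>"
    and Q: "continuous_map euclideanreal X Q" and join: "P 1 = \<gamma> 0" "\<gamma> 1 = Q 0"
    and ncP: "\<exists>t\<in>{0..1}. \<exists>t'\<in>{0..1}. P t \<noteq> P t'" and ncQ: "\<exists>t\<in>{0..1}. \<exists>t'\<in>{0..1}. Q t \<noteq> Q t'"
  obtains K where "continuous_map (prod_topology euclideanreal euclideanreal) X K"
    "\<And>t. K (0, t) = P (clamp01 t)" "\<And>t. K (1, t) = Q (clamp01 t)"
    "\<And>s. \<exists>t\<in>{0..1}. \<exists>t'\<in>{0..1}. K (s, t) \<noteq> K (s, t')"
    "\<And>s t. K (s, t) \<in> P ` {0..1} \<union> \<gamma> ` {0..1} \<union> Q ` {0..1}"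
proof -
  define R where "R u = (if u \<le> 1 then P (clamp01 u) else if u \<le> 2 then \<gamma> (clamp01 (u-1)) else Q (clamp01 (u-2)))" for u
  have sh: "continuous_map euclideanreal euclideanreal (\<lambda>u. clamp01 (u - c))" for c
    unfolding clamp01_def continuous_map_iff_continuous by (intro continuous_intros)
  have cP: "continuous_map euclideanreal X (\<lambda>u. P (clamp01 u))"
    using continuous_map_compose[OF continuous_map_clamp01 P] by (simp add: o_def)
  have c\<gamma>: "continuous_map euclideanreal X (\<lambda>u. \<gamma> (clamp01 (u-1)))"
    using continuous_map_compose[OF sh[of 1] \<gamma>] by (simp add: o_def)
  have cQ: "continuous_map euclideanreal X (\<lambda>u. Q (clamp01 (u-2)))"
    using continuous_map_compose[OF sh[of 2] Q] by (simp add: o_def)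
  have cR: "continuous_map euclideanreal X R"
    unfolding R_def
    by (intro continuous_map_cases_le continuous_map_from_subtopology cP c\<gamma> cQ)
      (auto simp: clamp01_def join)
  define l where "l s = max 0 (4 * clamp01 s - 2)" for s
  define r where "r s = min 3 (1 + 4 * clamp01 s)" for s
  have lr: "0 \<le> l s \<and> l s < r s \<and> r s \<le> 3" for s
  proof -
    have "0 \<le> max 0 (4 * c - 2) \<and> max 0 (4 * c - 2) < min 3 (1 + 4 * c) \<and> min 3 (1 + 4 * c) \<le> 3"
      if "0 \<le> c" "c \<le> 1" for c :: real using that by auto
    then show ?thesis unfolding l_def r_def using clamp01_in(2,3)[of s] by blast
  qed
  define K where "K z = R (l (fst z) + (r (fst z) - l (fst z)) * clamp01 (snd z))" for z
  have "continuous_on UNIV (\<lambda>z. l (fst z) + (r (fst z) - l (fst z)) * clamp01 (snd z))"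
    unfolding l_def r_def clamp01_def by (intro continuous_intros)
  then have "continuous_map (prod_topology euclideanreal euclideanreal) euclideanreal
          (\<lambda>z. l (fst z) + (r (fst z) - l (fst z)) * clamp01 (snd z))"
    by simp
  from continuous_map_compose[OF this cR]
  have cK: "continuous_map (prod_topology euclideanreal euclideanreal) X K"
    unfolding K_def o_def .
  have RP: "R t = P t" if "t \<in> {0..1}" for t using that by (simp add: R_def)
  have RQ: "R (2 + t) = Q t" if "t \<in> {0..1}" for t 
    using that by (cases "t = 0") (auto simp: R_def join)
  show thesis
  proof (rule that[OF cK])
    show "K (0, t) = P (clamp01 t)" for t
      by (simp add: K_def l_def r_def RP)
    show "K (1, t) = Q (clamp01 t)" for t
      by (simp add: K_def l_def r_def RQ)
    show "K (s, t) \<in> P ` {0..1} \<union> \<gamma> ` {0..1} \<union> Q ` {0..1}" for s t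
      by (simp add: K_def R_def)
    show "\<exists>t\<in>{0..1}. \<exists>t'\<in>{0..1}. K (s, t) \<noteq> K (s, t')" for s
    proof -
      have reach: "\<exists>t\<in>{0..1}. K (s, t) = R v" if "l s \<le> v" "v \<le> r s" for v
        using that lr[of s] by (intro bexI[of _ "(v - l s) / (r s - l s)"]) (auto simp: K_def)
      show ?thesis
      proof (cases "clamp01 s \<le> 1/2")
        case True
        obtain a b where ab: "a \<in> {0..1}" "b \<in> {0..1}" "P a \<noteq> P b" using ncP by blast
        have "l s = 0" "1 \<le> r s" using True clamp01_in(2)[of s] unfolding l_def r_def by simp_all
        then have "\<exists>t\<in>{0..1}. K (s, t) = P a" "\<exists>t\<in>{0..1}. K (s, t) = P b"
          using reach[of a] reach[of b] ab by (auto simp: RP)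
        then show ?thesis using ab(3) by metis
      next
        case False
        obtain a b where ab: "a \<in> {0..1}" "b \<in> {0..1}" "Q a \<noteq> Q b" using ncQ by blast
        have "l s \<le> 2" "r s = 3" using False clamp01_in(3)[of s] unfolding l_def r_def by simp_all
        then have "\<exists>t\<in>{0..1}. K (s, t) = Q a" "\<exists>t\<in>{0..1}. K (s, t) = Q b"
          using reach[of "2 + a"] reach[of "2 + b"] ab by (auto simp: RQ)
        then show ?thesis using ab(3) by metis
      qed
    qed
  qed
qed

context Metric_space
begin

text \<open>
  Attach to every piece \<open>S\<close> of the two families of \<open>dim_1_two_families\<close> a nonconstant path \<open>P S\<close> near \<open>S\<close>.
  A point \<open>y\<close> of a piece \<open>S\<close> of the first family and a piece \<open>S'\<close> of the second one moves along the path
  at stage \<open>\<theta> y\<close> of the homotopy from \<open>P S\<close> to \<open>P S'\<close>. Points with \<open>\<theta> y = 0\<close> belong to \<open>S\<close> only and follow \<open>P S\<close>,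
  whatever \<open>S'\<close> is, and similarly for \<open>\<theta> y = 1\<close>; so the finitely many closed parts of the definition agree
  where they overlap.
\<close>
lemma nonconstant_motion:
  assumes cpt: "compact_space mtopology" and lc: "locally_connected_space mtopology"
    and con: "connected_space mtopology" and dim: "covering_dim_le mtopology 1"
    and nt: "\<And>x. M \<noteq> {x}" and ne: "M \<noteq> {}" and "e > 0"
  shows "\<exists>H. continuous_map (prod_topology mtopology euclideanreal) mtopology H \<and>
    (\<forall>y\<in>M. (\<forall>t. d y (H (y, t)) < e) \<and> (\<exists>t\<in>{0..1}. \<exists>t'\<in>{0..1}. H (y, t) \<noteq> H (y, t')))"
proof -
  have e2: "e / 2 > 0" using \<open>e > 0\<close> by simp
  obtain \<delta> where \<delta>: "\<delta> > 0" "\<forall>x\<in>M. \<forall>y\<in>M. d x y < \<delta> \<longrightarrow>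
    (\<exists>p. continuous_map euclideanreal mtopology p \<and> p 0 = x \<and> p 1 = y \<and> (\<forall>t. p t \<in> mball x (e/2)))"
    using small_paths[OF cpt lc e2] by blast
  \<comment> \<open>The paths attached to two pieces that meet stay within \<open>2 * \<eta>\<close> of a common point, so their ends are
    less than \<open>\<delta>\<close> apart.\<close>
  define \<eta> where "\<eta> = min \<delta> e / 4"
  have \<eta>: "\<eta> > 0" "4 * \<eta> \<le> \<delta>" "4 * \<eta> \<le> e" using \<delta>(1) \<open>e > 0\<close> by (auto simp: \<eta>_def)
  obtain \<theta> \<A> \<B> where c\<theta>: "continuous_map mtopology euclideanreal \<theta>"
    and th: "\<forall>x\<in>M. 0 \<le> \<theta> x \<and> \<theta> x \<le> (1::real)"
    and A: "small_pieces \<eta> \<A>" "\<Union>\<A> = {x \<in> M. \<theta> x < 1}"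
    and B: "small_pieces \<eta> \<B>" "\<Union>\<B> = {x \<in> M. \<theta> x > 0}"
    by (rule dim_1_two_families[OF cpt dim \<eta>(1)]) blast
  define pt where "pt S = (SOME x. x \<in> M \<and> (S \<inter> M \<noteq> {} \<longrightarrow> x \<in> S))" for S
  have pt: "pt S \<in> M \<and> (S \<inter> M \<noteq> {} \<longrightarrow> pt S \<in> S)" for S
    unfolding pt_def using ne by (intro someI_ex[of "\<lambda>x. x \<in> M \<and> (S \<inter> M \<noteq> {} \<longrightarrow> x \<in> S)"]) blast
  have "\<forall>S. \<exists>p. continuous_map euclideanreal mtopology p \<and> (\<forall>t. p t \<in> mball (pt S) \<eta>) \<and>
     (\<exists>t\<in>{0..1}. \<exists>t'\<in>{0..1}. p t \<noteq> p t')"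
    using small_nonconstant_path[OF cpt lc con nt \<eta>(1)] pt by blast
  then obtain P where P: "\<And>S. continuous_map euclideanreal mtopology (P S)"
      "\<And>S t. P S t \<in> mball (pt S) \<eta>"
      "\<And>S. \<exists>t\<in>{0..1}. \<exists>t'\<in>{0..1}. P S t \<noteq> P S t'"
    by metis
  have PM: "P S t \<in> M" for S t using P(2)[of S t] by simp
  have near: "d z (P S t) < 2 * \<eta>" if "z \<in> S" "z \<in> M" "small \<eta> S" for z S t
  proof -
    have "d z (pt S) < \<eta>" using pt[of S] that by (auto simp: small_def)
    then show ?thesis using P(2)[of S t] triangle[of z "pt S" "P S t"] that(2) PM pt[of S] by auto
  qed
  \<comment> \<open>The homotopy is wanted for all pairs of pieces, but it has to be short only for pieces that meet.\<close>
  have "\<exists>K. continuous_map (prod_topology euclideanreal euclideanreal) mtopology K \<and>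
      (\<forall>t. K (0, t) = P S (clamp01 t)) \<and> (\<forall>t. K (1, t) = P S' (clamp01 t)) \<and>
      (\<forall>s. \<exists>t\<in>{0..1}. \<exists>t'\<in>{0..1}. K (s, t) \<noteq> K (s, t')) \<and>
      (small \<eta> S \<and> small \<eta> S' \<longrightarrow> (\<forall>z\<in>S \<inter> S' \<inter> M. \<forall>s t. d z (K (s, t)) < e))" for S S'
  proof -
    obtain \<gamma> where g: "continuous_map euclideanreal mtopology \<gamma>" "P S 1 = \<gamma> 0" "\<gamma> 1 = P S' 0"
      and gs: "small \<eta> S \<and> small \<eta> S' \<and> S \<inter> S' \<inter> M \<noteq> {} \<longrightarrow> (\<forall>t. \<gamma> t \<in> mball (P S 1) (e/2))"
    proof (cases "small \<eta> S \<and> small \<eta> S' \<and> S \<inter> S' \<inter> M \<noteq> {}")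
      case True
      then obtain z where z: "z \<in> S" "z \<in> S'" "z \<in> M" by blast
      have "d (P S 1) (P S' 0) < \<delta>"
        using near[of z S 1] near[of z S' 0] True z triangle[of "P S 1" z "P S' 0"] PM \<eta>(2) commute[of z "P S 1"]
        by simp
      then show thesis using \<delta>(2) PM that by metis
    next
      case False
      have conM: "connectedin mtopology M" using con by (metis connectedin_topspace topspace_mtopology)
      show thesis
      proof (rule path_near_connected[OF cpt lc conM PM PM \<open>e > 0\<close>, of S 1 S' 0])
        fix p assume "continuous_map euclideanreal mtopology p" "p 0 = P S 1" "p 1 = P S' 0"
        then show thesis using that[of p] False by auto
      qed
    qed
    obtain K where K: "continuous_map (prod_topology euclideanreal euclideanreal) mtopology K"
      "\<And>t. K (0, t) = P S (clamp01 t)" "\<And>t. K (1, t) = P S' (clamp01 t)"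
      "\<And>s. \<exists>t\<in>{0..1}. \<exists>t'\<in>{0..1}. K (s, t) \<noteq> K (s, t')"
      "\<And>s t. K (s, t) \<in> P S ` {0..1} \<union> \<gamma> ` {0..1} \<union> P S' ` {0..1}"
      using nonconstant_path_homotopy[OF P(1)[of S] g(1) P(1)[of S'] g(2,3) P(3) P(3)] by metis
    have "d z (K (s, t)) < e" if z: "z \<in> S \<inter> S' \<inter> M" and sm: "small \<eta> S" "small \<eta> S'" for z s t
    proof -
      have "\<gamma> t \<in> mball (P S 1) (e/2)" for t using gs z sm by blast
      then have "d z (\<gamma> t) < e" for t
        using near[of z S 1] z sm triangle[of z "P S 1" "\<gamma> t"] PM \<eta>(3) by (smt (verit) IntE field_sum_of_halves in_mball)
      moreover have "d z (P S t) < e" "d z (P S' t) < e" for t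
        using near[of z S t] near[of z S' t] z sm \<eta> by auto
      ultimately show ?thesis using K(5)[of s t] by auto
    qed
    then show ?thesis using K by blast
  qed
  then obtain K where K: "\<And>S S'. continuous_map (prod_topology euclideanreal euclideanreal) mtopology (K S S')"
      "\<And>S S' t. K S S' (0, t) = P S (clamp01 t)" "\<And>S S' t. K S S' (1, t) = P S' (clamp01 t)"
      "\<And>S S' s. \<exists>t\<in>{0..1}. \<exists>t'\<in>{0..1}. K S S' (s, t) \<noteq> K S S' (s, t')"
      "\<And>S S' z s t. small \<eta> S \<Longrightarrow> small \<eta> S' \<Longrightarrow> z \<in> S \<inter> S' \<inter> M \<Longrightarrow> d z (K S S' (s, t)) < e"
    by metis
  \<comment> \<open>The closed set \<open>F (S, S')\<close> consists of the points that may use the homotopy from \<open>P S\<close> to \<open>P S'\<close>: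
    those that lie in \<open>S\<close> unless \<open>\<theta> = 1\<close>, and in \<open>S'\<close> unless \<open>\<theta> = 0\<close>.\<close>
  define F where "F = (\<lambda>(S,S'). (M - \<Union>(\<A> - {S})) \<inter> (M - \<Union>(\<B> - {S'})))"
  define f where "f = (\<lambda>(S,S') z. K S S' (\<theta> (fst z), snd z))"
  let ?X = "prod_topology mtopology euclideanreal"
  have disjA: "S = T" if "S \<in> \<A>" "T \<in> \<A>" "y \<in> S" "y \<in> T" for S T y
    using A(1) that by (fastforce simp: small_pieces_def pairwise_def disjnt_iff)
  have disjB: "S = T" if "S \<in> \<B>" "T \<in> \<B>" "y \<in> S" "y \<in> T" for S T y
    using B(1) that by (fastforce simp: small_pieces_def pairwise_def disjnt_iff)
  have inF: "y \<in> F (S, S') \<longleftrightarrow> y \<in> M \<and> (\<theta> y < 1 \<longrightarrow> y \<in> S) \<and> (\<theta> y > 0 \<longrightarrow> y \<in> S')"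
    if S: "S \<in> \<A>" "S' \<in> \<B>" for y S S'
  proof
    assume "y \<in> F (S, S')"
    then have y: "y \<in> M" "y \<notin> \<Union>(\<A> - {S})" "y \<notin> \<Union>(\<B> - {S'})" by (auto simp: F_def)
    moreover have "\<theta> y < 1 \<Longrightarrow> y \<in> \<Union>\<A>" "\<theta> y > 0 \<Longrightarrow> y \<in> \<Union>\<B>" using A(2) B(2) y(1) by auto
    ultimately show "y \<in> M \<and> (\<theta> y < 1 \<longrightarrow> y \<in> S) \<and> (\<theta> y > 0 \<longrightarrow> y \<in> S')" by blast
  next
    assume y: "y \<in> M \<and> (\<theta> y < 1 \<longrightarrow> y \<in> S) \<and> (\<theta> y > 0 \<longrightarrow> y \<in> S')"
    have "y \<notin> T" if "T \<in> \<A> - {S}" for T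
    proof
      assume "y \<in> T"
      then have "\<theta> y < 1" using A(2) that by blast
      then show False using disjA[of S T y] S y that \<open>y \<in> T\<close> by blast
    qed
    moreover have "y \<notin> T" if "T \<in> \<B> - {S'}" for T
    proof
      assume "y \<in> T"
      then have "\<theta> y > 0" using B(2) that by blast
      then show False using disjB[of S' T y] S y that \<open>y \<in> T\<close> by blast
    qed
    ultimately show "y \<in> F (S, S')" using y by (auto simp: F_def)
  qed
  have cover: "\<exists>i\<in>\<A> \<times> \<B>. y \<in> F i" if y: "y \<in> M" for y
  proof -
    have "\<exists>S\<in>\<A>. \<theta> y < 1 \<longrightarrow> y \<in> S" using A y by (cases "\<theta> y < 1") (auto simp: small_pieces_def)
    moreover have "\<exists>S\<in>\<B>. \<theta> y > 0 \<longrightarrow> y \<in> S" using B y by (cases "\<theta> y > 0") (auto simp: small_pieces_def)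
    ultimately show ?thesis using inF y by blast
  qed
  obtain H where H: "continuous_map ?X mtopology H"
    "\<And>x i. \<lbrakk>i \<in> \<A> \<times> \<B>; x \<in> topspace ?X \<inter> (F i \<times> UNIV)\<rbrakk> \<Longrightarrow> H x = f i x"
  proof (rule pasting_lemma_exists_closed[of "\<A> \<times> \<B>" ?X "\<lambda>i. F i \<times> UNIV" mtopology f])
    show "finite (\<A> \<times> \<B>)" using A(1) B(1) by (auto simp: small_pieces_def)
    show "topspace ?X \<subseteq> (\<Union>i\<in>\<A> \<times> \<B>. F i \<times> UNIV)" using cover by auto
    show "closedin ?X (F i \<times> UNIV)" if "i \<in> \<A> \<times> \<B>" for i
    proof -
      obtain S S' where i: "i = (S, S')" "S \<in> \<A>" "S' \<in> \<B>" using \<open>i \<in> \<A> \<times> \<B>\<close> by blast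
      have "closedin mtopology (F i)"
        unfolding i F_def using small_pieces_closed_complement(1)[OF A(1) i(2)]
          small_pieces_closed_complement(1)[OF B(1) i(3)] by auto
      then show ?thesis by (auto simp: closedin_prod_Times_iff)
    qed
    show "continuous_map (subtopology ?X (F i \<times> UNIV)) mtopology (f i)" if "i \<in> \<A> \<times> \<B>" for i
    proof -
      obtain S S' where i: "i = (S, S')" by (cases i)
      have "continuous_map ?X (prod_topology euclideanreal euclideanreal) (\<lambda>z. (\<theta> (fst z), snd z))"
        using continuous_map_compose[OF continuous_map_fst c\<theta>] 
        by (intro continuous_map_pairedI continuous_map_snd) (simp add: o_def)
      from continuous_map_compose[OF this K(1)[of S S']]
      have "continuous_map ?X mtopology (f i)" unfolding f_def o_def i by simp
      then show ?thesis by (rule continuous_map_from_subtopology)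
    qed
    fix i j z assume ij: "i \<in> \<A> \<times> \<B>" "j \<in> \<A> \<times> \<B>" and z: "z \<in> topspace ?X \<inter> (F i \<times> UNIV) \<inter> (F j \<times> UNIV)"
    obtain S S' where i: "i = (S, S')" "S \<in> \<A>" "S' \<in> \<B>" using ij by blast
    obtain T T' where j: "j = (T, T')" "T \<in> \<A>" "T' \<in> \<B>" using ij by blast
    obtain y t where zyt: "z = (y, t)" by (cases z)
    have yi: "y \<in> F (S,S')" and yj: "y \<in> F (T,T')" and yM: "y \<in> M" using z zyt i j by auto
    have mem: "\<theta> y < 1 \<Longrightarrow> S = T" "\<theta> y > 0 \<Longrightarrow> S' = T'"
      using yi yj inF[OF i(2,3), of y] inF[OF j(2,3), of y] disjA[OF i(2) j(2), of y] disjB[OF i(3) j(3), of y] by auto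
    consider "\<theta> y = 0" | "\<theta> y = 1" | "0 < \<theta> y" "\<theta> y < 1" using th yM by force
    then show "f i z = f j z"
    proof cases
      case 1
      then show ?thesis using mem K(2) by (simp add: f_def i j zyt)
    next
      case 2
      then show ?thesis using mem K(3) by (simp add: f_def i j zyt)
    next
      case 3
      then show ?thesis using mem by (simp add: f_def i j)
    qed
  qed (rule that)
  have "(\<forall>t. d y (H (y, t)) < e) \<and> (\<exists>t\<in>{0..1}. \<exists>t'\<in>{0..1}. H (y, t) \<noteq> H (y, t'))" if y: "y \<in> M" for y
  proof -
    obtain S S' where S: "S \<in> \<A>" "S' \<in> \<B>" "y \<in> F (S, S')" using cover[OF y] by blast
    have Hy: "H (y, t) = K S S' (\<theta> y, t)" for t
      using H(2)[of "(S,S')" "(y,t)"] S y by (simp add: f_def)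
    have sm: "small \<eta> S" "small \<eta> S'" using S A(1) B(1) by (auto simp: small_pieces_def)
    have mem: "\<theta> y < 1 \<Longrightarrow> y \<in> S" "\<theta> y > 0 \<Longrightarrow> y \<in> S'" using S(3) inF[OF S(1,2)] by auto
    consider "\<theta> y = 0" | "\<theta> y = 1" | "0 < \<theta> y" "\<theta> y < 1" using th y by force
    then have "d y (H (y, t)) < e" for t
    proof cases
      case 1
      then show ?thesis using near[of y S "clamp01 t"] mem y sm \<eta> by (simp add: Hy K(2))
    next
      case 2
      then show ?thesis using near[of y S' "clamp01 t"] mem y sm \<eta> by (simp add: Hy K(3))
    next
      case 3
      then show ?thesis using K(5)[OF sm] mem y by (simp add: Hy)
    qed
    then show ?thesis using K(4)[of S S' "\<theta> y"] by (simp add: Hy)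
  qed
  then show ?thesis using H(1) by blast
qed

text \<open>
  If \<open>H (y, \<cdot>)\<close> takes two values, at times \<open>t\<close> and \<open>t'\<close>, these have disjoint neighbourhoods. For \<open>y'\<close> near \<open>y\<close>
  the points \<open>H (y', t)\<close> and \<open>H (y', t')\<close> stay in them, and any given \<open>w\<close> lies outside one of the two. The choice
  between \<open>t\<close> and \<open>t'\<close> thus depends on \<open>w\<close> but not on \<open>y'\<close>, and a Lebesgue number makes the
  neighbourhood of \<open>y\<close> uniform.
\<close>
lemma nonconstant_motion_avoids:
  assumes cpt: "compact_space mtopology" and H: "continuous_map (prod_topology mtopology euclideanreal) mtopology H"
    and nc: "\<And>y. y \<in> M \<Longrightarrow> \<exists>t\<in>{0..1}. \<exists>t'\<in>{0..1}. H (y, t) \<noteq> H (y, t')"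
  shows "\<exists>\<kappa>>0. \<forall>y\<in>M. \<forall>w. \<exists>t\<in>{0..1}. \<forall>y'\<in>mball y \<kappa>. H (y', t) \<noteq> w"
proof -
  define \<U> where "\<U> = {N. openin mtopology N \<and> (\<forall>w. \<exists>t\<in>{0..1}. \<forall>y'\<in>N. H (y', t) \<noteq> w)}"
  have "M \<subseteq> \<Union>\<U>"
  proof
    fix y assume y: "y \<in> M"
    then obtain t t' where t: "t \<in> {0..1}" "t' \<in> {0..1}" "H (y, t) \<noteq> H (y, t')" using nc by blast
    have "H (y, s) \<in> M" for s using H y by (auto simp: continuous_map_def)
    then obtain U V where UV: "openin mtopology U" "openin mtopology V" "H (y, t) \<in> U" "H (y, t') \<in> V" "disjnt U V"
      using Hausdorff_space_mtopology t(3) unfolding Hausdorff_space_def topspace_mtopology by metis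
    have cs: "continuous_map mtopology mtopology (\<lambda>y. H (y, s))" for s
      using continuous_map_compose[OF _ H, of mtopology "\<lambda>y. (y, s)"]
      by (simp add: o_def continuous_map_pairedI)
    define N where "N = {y \<in> topspace mtopology. H (y, t) \<in> U} \<inter> {y \<in> topspace mtopology. H (y, t') \<in> V}"
    have "openin mtopology N"
      unfolding N_def using openin_continuous_map_preimage[OF cs UV(1)] openin_continuous_map_preimage[OF cs UV(2)] by blast
    moreover have "y \<in> N" using y UV by (simp add: N_def)
    moreover have "\<exists>t\<in>{0..1}. \<forall>y'\<in>N. H (y', t) \<noteq> w" for w
    proof (cases "w \<in> U")
      case True
      then have "w \<notin> V" using UV by (auto simp: disjnt_iff)
      then show ?thesis using t by (auto simp: N_def)
    next
      case False
      then show ?thesis using t by (auto simp: N_def)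
    qed
    ultimately show "y \<in> \<Union>\<U>" unfolding \<U>_def by blast
  qed
  then show ?thesis
  proof (rule compact_cover_Lebesgue_number[OF cpt, rotated])
    fix r :: real assume r: "r > 0" "\<And>x. x \<in> M \<Longrightarrow> \<exists>U\<in>\<U>. mball x r \<subseteq> U"
    have "\<exists>t\<in>{0..1}. \<forall>y'\<in>mball y r. H (y', t) \<noteq> w" if "y \<in> M" for y w
      using r(2)[OF that] unfolding \<U>_def by blast
    then show ?thesis using r(1) by blast
  qed (auto simp: \<U>_def)
qed

end

section \<open>Zero-dimensional maps as the intersection of open sets of maps\<close>

text \<open>
  Two disjoint open sets of the whole space, rather than a relatively clopen subset of the fibre, are
  required because they keep working for all maps near \<open>f\<close>.
\<close>
definition split_maps :: "'a metric \<Rightarrow> 'b metric \<Rightarrow> real \<Rightarrow> ('a \<Rightarrow> 'b) set" where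
  "split_maps m m' \<delta> = {f \<in> mspace (cfunspace (mtopology_of m) m').
     \<forall>x\<in>mspace m. \<exists>U V. openin (mtopology_of m) U \<and> openin (mtopology_of m) V \<and> disjnt U V \<and> x \<in> U \<and>
        {z \<in> mspace m. f z = f x} \<subseteq> U \<union> V \<and> (\<forall>a\<in>U. \<forall>b\<in>U. mdist m a b < \<delta>)}"

lemma finite_subcover:
  assumes "compact_space X" "\<And>x. x \<in> topspace X \<Longrightarrow> openin X (G x) \<and> x \<in> G x"
  obtains K where "finite K" "K \<subseteq> topspace X" "topspace X \<subseteq> (\<Union>x\<in>K. G x)"
proof -
  have "\<forall>U\<in>G ` topspace X. openin X U" "topspace X \<subseteq> \<Union>(G ` topspace X)" using assms(2) by auto
  then obtain \<F> where \<F>: "finite \<F>" "\<F> \<subseteq> G ` topspace X" "topspace X \<subseteq> \<Union>\<F>"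
    using assms(1) unfolding compact_space_alt by meson
  then obtain K where K: "K \<subseteq> topspace X" "finite K" "\<F> = G ` K"
    using finite_subset_image[OF \<F>(1,2)] by blast
  then show thesis using \<F> by (intro that[of K]) simp_all
qed

text \<open>
  As \<open>f\<close> is a closed map, the open set \<open>U \<union> V\<close> that contains the fibre through \<open>x\<close> contains the preimage of
  a ball about \<open>f x\<close>, and hence all fibres of nearby maps through points near \<open>x\<close>.
\<close>
lemma openin_split_maps:
  assumes cpt: "compact_space (mtopology_of m)"
  shows "openin (mtopology_of (cfunspace (mtopology_of m) m')) (split_maps m m' \<delta>)"
proof -
  let ?C = "cfunspace (mtopology_of m) m'"
  interpret C: Metric_space "mspace ?C" "mdist ?C" by (rule Metric_space_mspace_mdist)
  interpret N: Metric_space "mspace m'" "mdist m'" by (rule Metric_space_mspace_mdist)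
  have mC: "mtopology_of ?C = C.mtopology" by (simp only: mtopology_of_def)
  have "\<exists>r>0. C.mball f r \<subseteq> split_maps m m' \<delta>" if f: "f \<in> split_maps m m' \<delta>" for f
  proof -
    have fC: "f \<in> mspace ?C" using f unfolding split_maps_def by blast
    then have fc: "continuous_map (mtopology_of m) (mtopology_of m') f" 
      and fim: "\<And>x. x \<in> mspace m \<Longrightarrow> f x \<in> mspace m'" by auto
    have clo: "closed_map (mtopology_of m) (mtopology_of m') f"
      by (rule T1_Spaces.continuous_imp_closed_map[OF fc cpt])
        (simp add: mtopology_of_def N.Hausdorff_space_mtopology)
    \<comment> \<open>The factor 3 leaves room for the distance from \<open>f x\<close> to \<open>f z\<close> and for two passages between \<open>f\<close> and \<open>g\<close>.\<close>
    have "\<exists>U V r. openin (mtopology_of m) U \<and> openin (mtopology_of m) V \<and> disjnt U V \<and> x \<in> U \<and>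
        (\<forall>a\<in>U. \<forall>b\<in>U. mdist m a b < \<delta>) \<and> r > 0 \<and>
        (\<forall>z\<in>mspace m. mdist m' (f x) (f z) < 3 * r \<longrightarrow> z \<in> U \<union> V)" if x: "x \<in> mspace m" for x
    proof -
      obtain U V where UV: "openin (mtopology_of m) U" "openin (mtopology_of m) V" "disjnt U V" "x \<in> U"
        "{z \<in> mspace m. f z = f x} \<subseteq> U \<union> V" "\<forall>a\<in>U. \<forall>b\<in>U. mdist m a b < \<delta>"
        using f x unfolding split_maps_def by blast
      have "closedin (mtopology_of m) (topspace (mtopology_of m) - (U \<union> V))"
        using UV by (intro closedin_diff closedin_topspace openin_Un)
      then have "closedin (mtopology_of m') (f ` (mspace m - (U \<union> V)))"
        using clo by (simp add: closed_map_def)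
      then have "openin N.mtopology (mspace m' - f ` (mspace m - (U \<union> V)))"
        by (metis mtopology_of_def openin_diff openin_topspace topspace_mtopology_of)
      moreover have "f x \<in> mspace m' - f ` (mspace m - (U \<union> V))"
        using fim[OF x] UV(5) by auto
      ultimately obtain s where s: "s > 0" "N.mball (f x) s \<subseteq> mspace m' - f ` (mspace m - (U \<union> V))"
        unfolding N.openin_mtopology by meson
      have "z \<in> U \<union> V" if "z \<in> mspace m" "mdist m' (f x) (f z) < 3 * (s/3)" for z
      proof -
        have "f z \<in> N.mball (f x) s" using that fim x by simp
        then show ?thesis using s(2) that(1) by blast
      qed
      then show ?thesis using UV s(1) by (intro exI[of _ U] exI[of _ V] exI[of _ "s/3"]) auto
    qed
    then obtain U V r where UVr: "\<And>x. x \<in> mspace m \<Longrightarrow> openin (mtopology_of m) (U x) \<and> openin (mtopology_of m) (V x) \<and>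
        disjnt (U x) (V x) \<and> x \<in> U x \<and> (\<forall>a\<in>U x. \<forall>b\<in>U x. mdist m a b < \<delta>) \<and> r x > 0 \<and>
        (\<forall>z\<in>mspace m. mdist m' (f x) (f z) < 3 * r x \<longrightarrow> z \<in> U x \<union> V x)"
      by metis
    define G where "G x = U x \<inter> {z \<in> topspace (mtopology_of m). f z \<in> N.mball (f x) (r x)}" for x
    have "openin (mtopology_of m) (G x) \<and> x \<in> G x" if "x \<in> topspace (mtopology_of m)" for x
    proof -
      have "openin (mtopology_of m') (N.mball (f x) (r x))" by (simp add: mtopology_of_def)
      then have "openin (mtopology_of m) {z \<in> topspace (mtopology_of m). f z \<in> N.mball (f x) (r x)}"
        by (rule openin_continuous_map_preimage[OF fc])
      then show ?thesis using UVr[of x] that fim[of x] by (auto simp: G_def)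
    qed
    then obtain K where K: "finite K" "K \<subseteq> mspace m" "mspace m \<subseteq> (\<Union>x\<in>K. G x)"
      using finite_subcover[OF cpt, of G] unfolding topspace_mtopology_of by blast
    define \<rho> where "\<rho> = Min (insert 1 (r ` K))"
    have \<rho>: "\<rho> > 0" "\<And>x. x \<in> K \<Longrightarrow> \<rho> \<le> r x" using K UVr by (auto simp: \<rho>_def)
    have "g \<in> split_maps m m' \<delta>" if g: "g \<in> C.mball f \<rho>" for g
    proof -
      have gC: "g \<in> mspace ?C" and dfg: "mdist ?C f g < \<rho>" using g unfolding C.in_mball by blast+
      have close: "mdist m' (f x) (g x) < \<rho>" if "x \<in> mspace m" for x
        using mdist_cfunspace_imp_mdist_le[OF fC gC order_refl, of x] that dfg by simp
      have gim: "\<And>x. x \<in> mspace m \<Longrightarrow> g x \<in> mspace m'" using gC by auto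
      have "\<exists>U V. openin (mtopology_of m) U \<and> openin (mtopology_of m) V \<and> disjnt U V \<and> z \<in> U \<and>
        {z' \<in> mspace m. g z' = g z} \<subseteq> U \<union> V \<and> (\<forall>a\<in>U. \<forall>b\<in>U. mdist m a b < \<delta>)" if z: "z \<in> mspace m" for z
      proof -
        obtain x where x: "x \<in> K" "z \<in> G x" using K z by blast
        then have xM: "x \<in> mspace m" using K by blast
        have "z' \<in> U x \<union> V x" if z': "z' \<in> mspace m" "g z' = g z" for z'
        proof -
          have "mdist m' (f x) (f z) < r x" using x by (simp add: G_def)
          moreover have "mdist m' (f z) (f z') \<le> mdist m' (f z) (g z) + mdist m' (f z') (g z')"
            using N.triangle[of "f z" "g z" "f z'"] fim gim z z' N.commute by simp
          moreover have "mdist m' (f x) (f z') \<le> mdist m' (f x) (f z) + mdist m' (f z) (f z')"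
            using N.triangle fim xM z z' by simp
          ultimately have "mdist m' (f x) (f z') < 3 * r x"
            using close[OF z] close[OF z'(1)] \<rho>(2)[OF x(1)] by linarith
          then show ?thesis using UVr[OF xM] z' by blast
        qed
        then show ?thesis using UVr[OF xM] x
          by (intro exI[of _ "U x"] exI[of _ "V x"]) (auto simp: G_def)
      qed
      then show ?thesis using gC unfolding split_maps_def by blast
    qed
    then show ?thesis using \<rho>(1) by blast
  qed
  moreover have "split_maps m m' \<delta> \<subseteq> mspace ?C" unfolding split_maps_def by blast
  ultimately show ?thesis unfolding mC C.openin_mtopology by blast
qed

lemma clopen_disjoint_refinement:
  assumes "finite \<C>" "\<And>C. C \<in> \<C> \<Longrightarrow> openin X C \<and> closedin X C"
  shows "\<exists>\<V>. finite \<V> \<and> pairwise disjnt \<V> \<and> (\<forall>V\<in>\<V>. openin X V) \<and> \<Union>\<V> = \<Union>\<C> \<and> (\<forall>V\<in>\<V>. \<exists>C\<in>\<C>. V \<subseteq> C)"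
  using assms
proof (induction \<C> rule: finite_induct)
  case empty
  then show ?case by (intro exI[of _ "{}"]) auto
next
  case (insert C \<C>)
  then obtain \<V> where V: "finite \<V>" "pairwise disjnt \<V>" "\<forall>V\<in>\<V>. openin X V" "\<Union>\<V> = \<Union>\<C>" "\<forall>V\<in>\<V>. \<exists>C\<in>\<C>. V \<subseteq> C"
    by (metis insertCI)
  have "closedin X (\<Union>\<C>)" using insert by (intro closedin_Union) auto
  then have "openin X (C - \<Union>\<C>)" using insert.prems[of C] by (intro openin_diff) auto
  moreover have "pairwise disjnt (insert (C - \<Union>\<C>) \<V>)"
    unfolding pairwise_insert using V(2,4) by (auto simp: disjnt_iff)
  moreover have "\<Union>(insert (C - \<Union>\<C>) \<V>) = \<Union>(insert C \<C>)" using V(4) by auto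
  moreover have "\<forall>V\<in>insert (C - \<Union>\<C>) \<V>. \<exists>D\<in>insert C \<C>. V \<subseteq> D" using V(5) by blast
  ultimately show ?case using V by (intro exI[of _ "insert (C - \<Union>\<C>) \<V>"]) auto
qed

text \<open>
  An open cover of order zero consists of disjoint, hence relatively clopen sets; by normality
  such a set and its complement in \<open>F\<close> have disjoint neighbourhoods. Conversely, small clopen
  neighbourhoods refine a given cover, finitely many of them suffice, and subtracting earlier ones
  from later ones makes them disjoint.
\<close>
lemma covering_dim_le_0_iff_small_splits:
  assumes cpt: "compact_space (mtopology_of m)" and F: "closedin (mtopology_of m) F"
  shows "covering_dim_le (subtopology (mtopology_of m) F) 0 \<longleftrightarrow>
     (\<forall>\<delta>>0. \<forall>x\<in>F. \<exists>U V. openin (mtopology_of m) U \<and> openin (mtopology_of m) V \<and> disjnt U V \<and> x \<in> U \<and>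
        F \<subseteq> U \<union> V \<and> (\<forall>a\<in>U. \<forall>b\<in>U. mdist m a b < \<delta>))"
    (is "?L \<longleftrightarrow> ?R")
proof -
  interpret M: Metric_space "mspace m" "mdist m" by (rule Metric_space_mspace_mdist)
  have top: "mtopology_of m = M.mtopology" by (simp add: mtopology_of_def)
  let ?S = "subtopology (mtopology_of m) F"
  have FM: "F \<subseteq> mspace m" using closedin_subset[OF F] by simp
  have tS: "topspace ?S = F" using FM by auto
  have cptS: "compact_space ?S"
    by (intro compact_space_subtopology closedin_compact_space cpt F)
  show ?thesis
  proof
    assume L: ?L
    show ?R
    proof (intro allI impI ballI)
      fix \<delta> :: real and x assume \<delta>: "\<delta> > 0" and x: "x \<in> F"
      have "openin ?S (F \<inter> M.mball y (\<delta>/2)) \<and> y \<in> F \<inter> M.mball y (\<delta>/2)" if "y \<in> topspace ?S" for y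
        using that \<delta> FM by (auto simp: top openin_subtopology_Int2)
      then obtain K where K: "finite K" "K \<subseteq> F" "F \<subseteq> (\<Union>y\<in>K. F \<inter> M.mball y (\<delta>/2))"
        using finite_subcover[OF cptS, of "\<lambda>y. F \<inter> M.mball y (\<delta>/2)"] unfolding tS by blast
      let ?U = "(\<lambda>y. F \<inter> M.mball y (\<delta>/2)) ` K"
      have "finite ?U \<and> (\<forall>U\<in>?U. openin ?S U) \<and> \<Union>?U = topspace ?S"
        using K by (auto simp: top openin_subtopology_Int2 tS)
      then obtain \<V> where V: "finite \<V>" "\<forall>V\<in>\<V>. openin ?S V" "\<Union>\<V> = F" "\<forall>V\<in>\<V>. \<exists>U\<in>?U. V \<subseteq> U"
          "\<forall>x\<in>F. card {V\<in>\<V>. x \<in> V} \<le> 1"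
        using L[unfolded covering_dim_le_def, rule_format, of ?U] unfolding tS by auto
      have uniq: "V = W" if "V \<in> \<V>" "W \<in> \<V>" "z \<in> V" "z \<in> W" for V W z
      proof -
        have "z \<in> F" using that V(3) by blast
        then have "card {V\<in>\<V>. z \<in> V} \<le> Suc 0" using V(5) by simp
        then show ?thesis using that V(1) by (simp add: card_le_Suc0_iff_eq)
      qed
      obtain V0 where V0: "V0 \<in> \<V>" "x \<in> V0" using V(3) x by blast
      have op: "openin ?S (\<Union>(\<V> - {V0}))" using V(2) by (intro openin_Union) auto
      have eq: "F - V0 = \<Union>(\<V> - {V0})" using V(3) uniq V0(1) by blast
      have V0F: "V0 \<subseteq> F" using V0 V(3) by blast
      have "closedin ?S (F - \<Union>(\<V> - {V0}))" "closedin ?S (F - V0)"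
        using op V(2) V0(1) closedin_topspace[of ?S] unfolding tS by (auto intro: closedin_diff)
      moreover have "F - \<Union>(\<V> - {V0}) = V0" using eq V0F by blast
      ultimately have "closedin (mtopology_of m) V0" "closedin (mtopology_of m) (F - V0)"
        using closedin_closed_subtopology[OF F] by auto
      then obtain U W where UW: "openin (mtopology_of m) U" "openin (mtopology_of m) W" "V0 \<subseteq> U" "F - V0 \<subseteq> W" "disjnt U W"
        using M.normal_space_mtopology unfolding top normal_space_def by (metis Diff_disjoint disjnt_def)
      obtain y where y: "V0 \<subseteq> M.mball y (\<delta>/2)" using V(4) V0(1) by blast
      have sm: "mdist m a b < \<delta>" if "a \<in> M.mball y (\<delta>/2)" "b \<in> M.mball y (\<delta>/2)" for a b
        using that M.triangle[of a y b] M.commute[of a y] by auto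
      show "\<exists>U V. openin (mtopology_of m) U \<and> openin (mtopology_of m) V \<and> disjnt U V \<and> x \<in> U \<and>
        F \<subseteq> U \<union> V \<and> (\<forall>a\<in>U. \<forall>b\<in>U. mdist m a b < \<delta>)"
      proof (rule exI[of _ "U \<inter> M.mball y (\<delta>/2)"], rule exI[of _ W], intro conjI)
        show "openin (mtopology_of m) (U \<inter> M.mball y (\<delta>/2))" using UW(1) by (simp add: top openin_Int)
        show "disjnt (U \<inter> M.mball y (\<delta>/2)) W" using UW(5) by (auto simp: disjnt_iff)
      qed (use UW V0 y sm in blast)+
    qed
  next
    assume R: ?R
    show ?L
      unfolding covering_dim_le_def tS
    proof (intro allI impI)
      fix \<U> assume U: "finite \<U> \<and> (\<forall>U\<in>\<U>. openin ?S U) \<and> \<Union>\<U> = F"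
      have "\<exists>C. openin ?S C \<and> closedin ?S C \<and> x \<in> C \<and> (\<exists>U\<in>\<U>. C \<subseteq> U)" if x: "x \<in> F" for x
      proof -
        obtain U0 where U0: "U0 \<in> \<U>" "x \<in> U0" using U x by blast
        then obtain O' where O: "openin (mtopology_of m) O'" "U0 = O' \<inter> F" using U unfolding openin_subtopology by blast
        then obtain r where r: "r > 0" "M.mball x r \<subseteq> O'" using U0 unfolding top M.openin_mtopology by blast
        obtain V W where VW: "openin (mtopology_of m) V" "openin (mtopology_of m) W" "disjnt V W" "x \<in> V"
          "F \<subseteq> V \<union> W" "\<forall>a\<in>V. \<forall>b\<in>V. mdist m a b < r"
          using R r(1) x by meson
        have "openin ?S (F \<inter> V)" "openin ?S (F \<inter> W)" using VW by (auto simp: openin_subtopology_Int2)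
        moreover have "F \<inter> V = topspace ?S - F \<inter> W" using VW(3,5) unfolding tS by (auto simp: disjnt_iff)
        ultimately have "openin ?S (F \<inter> V)" "closedin ?S (F \<inter> V)"
          by (simp, metis closedin_diff closedin_topspace)
        moreover have "F \<inter> V \<subseteq> U0" 
        proof
          fix a assume a: "a \<in> F \<inter> V"
          then have "a \<in> M.mball x r" using VW(4,6) x FM by auto
          then show "a \<in> U0" using r O a by blast
        qed
        ultimately show ?thesis using U0 VW(4) x by blast
      qed
      then obtain C where C: "\<And>x. x \<in> F \<Longrightarrow> openin ?S (C x) \<and> closedin ?S (C x) \<and> x \<in> C x \<and> (\<exists>U\<in>\<U>. C x \<subseteq> U)"
        by metis
      have Cop: "\<And>x. x \<in> topspace ?S \<Longrightarrow> openin ?S (C x) \<and> x \<in> C x"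
        using C unfolding tS by blast
      obtain K where K: "finite K" "K \<subseteq> F" "F \<subseteq> (\<Union>x\<in>K. C x)"
        using finite_subcover[OF cptS Cop] unfolding tS by blast
      have "openin ?S D \<and> closedin ?S D" if "D \<in> C ` K" for D using that C K by blast
      then have "\<exists>\<V>. finite \<V> \<and> pairwise disjnt \<V> \<and> (\<forall>V\<in>\<V>. openin ?S V) \<and> \<Union>\<V> = \<Union>(C ` K) \<and>
          (\<forall>V\<in>\<V>. \<exists>D\<in>C ` K. V \<subseteq> D)"
        by (intro clopen_disjoint_refinement finite_imageI K(1)) 
      then obtain \<V> where V: "finite \<V>" "pairwise disjnt \<V>" "\<forall>V\<in>\<V>. openin ?S V" "\<Union>\<V> = \<Union>(C ` K)" "\<forall>V\<in>\<V>. \<exists>D\<in>C ` K. V \<subseteq> D"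
        by blast
      have "\<Union>\<V> = F"
      proof
        show "\<Union>\<V> \<subseteq> F" using V(3) openin_subset[of ?S] unfolding tS by blast
        show "F \<subseteq> \<Union>\<V>" using K V(4) by simp
      qed
      moreover have "\<forall>V\<in>\<V>. \<exists>U\<in>\<U>. V \<subseteq> U"
      proof
        fix V assume "V \<in> \<V>"
        then obtain y where y: "y \<in> K" "V \<subseteq> C y" using V(5) by blast
        then obtain U where "U \<in> \<U>" "C y \<subseteq> U" using C K(2) by blast
        then show "\<exists>U\<in>\<U>. V \<subseteq> U" using y by blast
      qed
      moreover have "card {V\<in>\<V>. x \<in> V} \<le> 0 + 1" for x
        using V(1,2) by (auto simp: card_le_Suc0_iff_eq pairwise_def disjnt_iff)
      ultimately show "\<exists>\<V>. finite \<V> \<and> (\<forall>V\<in>\<V>. openin ?S V) \<and> \<Union>\<V> = F \<and> (\<forall>V\<in>\<V>. \<exists>U\<in>\<U>. V \<subseteq> U) \<and>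
          (\<forall>x\<in>F. card {V\<in>\<V>. x \<in> V} \<le> 0 + 1)"
        using V(1,3) by (intro exI[of _ \<V>] conjI) simp_all
    qed
  qed
qed

lemma zero_dimensional_maps_eq:
  assumes cpt: "compact_space (mtopology_of m)"
  shows "n_dimensional_maps 0 (mtopology_of m) m' = (\<Inter>n. split_maps m m' (inverse (real (Suc n))))"
proof -
  let ?C = "cfunspace (mtopology_of m) m'"
  interpret N: Metric_space "mspace m'" "mdist m'" by (rule Metric_space_mspace_mdist)
  have clo: "closedin (mtopology_of m) {z \<in> mspace m. f z = y}" if "f \<in> mspace ?C" for f y
  proof (cases "y \<in> mspace m'")
    case True
    have "closedin (mtopology_of m') {y}"
      using True N.Hausdorff_space_mtopology by (simp add: mtopology_of_def closedin_Hausdorff_sing_eq)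
    then have "closedin (mtopology_of m) {z \<in> topspace (mtopology_of m). f z \<in> {y}}"
      using that by (intro closedin_continuous_map_preimage) auto
    then show ?thesis by simp
  next
    case False
    then have "{z \<in> mspace m. f z = y} = {}" using that by auto
    then show ?thesis by (simp only: closedin_empty)
  qed
  have "(\<forall>y\<in>mspace m'. covering_dim_le (subtopology (mtopology_of m) {z \<in> mspace m. f z = y}) 0) \<longleftrightarrow>
     (\<forall>n. f \<in> split_maps m m' (inverse (real (Suc n))))" (is "?L \<longleftrightarrow> ?R") if f: "f \<in> mspace ?C" for f
  proof
    assume L: ?L
    show ?R
      unfolding split_maps_def
    proof (intro allI CollectI conjI ballI f)
      fix n x assume x: "x \<in> mspace m"
      have "f x \<in> mspace m'" using f x by auto
      with L have "covering_dim_le (subtopology (mtopology_of m) {z \<in> mspace m. f z = f x}) 0" by blast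
      moreover have "inverse (real (Suc n)) > 0" by simp
      moreover have "x \<in> {z \<in> mspace m. f z = f x}" using x by simp
      ultimately show "\<exists>U V. openin (mtopology_of m) U \<and> openin (mtopology_of m) V \<and> disjnt U V \<and> x \<in> U \<and>
        {z \<in> mspace m. f z = f x} \<subseteq> U \<union> V \<and> (\<forall>a\<in>U. \<forall>b\<in>U. mdist m a b < inverse (real (Suc n)))"
        unfolding covering_dim_le_0_iff_small_splits[OF cpt clo[OF f]] by blast
    qed
  next
    assume R: ?R
    show ?L
    proof
      fix y assume "y \<in> mspace m'"
      show "covering_dim_le (subtopology (mtopology_of m) {z \<in> mspace m. f z = y}) 0"
        unfolding covering_dim_le_0_iff_small_splits[OF cpt clo[OF f]]
      proof (intro allI impI ballI)
        fix \<delta> :: real and x assume "\<delta> > 0" and x: "x \<in> {z \<in> mspace m. f z = y}"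
        then obtain n where n: "inverse (real (Suc n)) < \<delta>" using reals_Archimedean by blast
        have "f \<in> split_maps m m' (inverse (real (Suc n)))" using R by blast
        then obtain U V where "openin (mtopology_of m) U" "openin (mtopology_of m) V" "disjnt U V" "x \<in> U"
           "{z \<in> mspace m. f z = f x} \<subseteq> U \<union> V" "\<forall>a\<in>U. \<forall>b\<in>U. mdist m a b < inverse (real (Suc n))"
          using x unfolding split_maps_def by blast
        moreover from this have "\<forall>a\<in>U. \<forall>b\<in>U. mdist m a b < \<delta>" using n by force
        ultimately show "\<exists>U V. openin (mtopology_of m) U \<and> openin (mtopology_of m) V \<and> disjnt U V \<and> x \<in> U \<and>
          {z \<in> mspace m. f z = y} \<subseteq> U \<union> V \<and> (\<forall>a\<in>U. \<forall>b\<in>U. mdist m a b < \<delta>)"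
          using x by (intro exI[of _ U] exI[of _ V]) auto
      qed
    qed
  qed
  moreover have "f \<in> mspace ?C" if "f \<in> split_maps m m' \<delta>" for f \<delta>
    using that unfolding split_maps_def by blast
  ultimately show ?thesis
    unfolding n_dimensional_maps_def topspace_mtopology_of by blast
qed

lemma zero_DIM_I:
  assumes cpt: "compact_space X" and met: "metrizable_space X"
    and dense: "\<And>m \<delta> f \<epsilon>. \<lbrakk>mtopology_of m = X; \<delta> > 0; \<epsilon> > 0; f \<in> mspace (cfunspace X m)\<rbrakk>
       \<Longrightarrow> \<exists>g\<in>split_maps m m \<delta>. mdist (cfunspace X m) f g < \<epsilon>"
  shows "zero_DIM X"
  unfolding zero_DIM_def
proof (intro conjI allI impI cpt met)
  fix m assume m: "mtopology_of m = X"
  let ?C = "cfunspace X m"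
  let ?O = "\<lambda>n. split_maps m m (inverse (real (Suc n)))"
  interpret C: Metric_space "mspace ?C" "mdist ?C" by (rule Metric_space_mspace_mdist)
  interpret M: Metric_space "mspace m" "mdist m" by (rule Metric_space_mspace_mdist)
  have mC: "mtopology_of ?C = C.mtopology" by (simp only: mtopology_of_def)
  have cptm: "compact_space (mtopology_of m)" using cpt m by simp
  have eq: "n_dimensional_maps 0 X m = \<Inter>(range ?O)"
    using zero_dimensional_maps_eq[OF cptm, of m] m by simp
  have op: "openin C.mtopology (?O n)" for n
    using openin_split_maps[OF cptm, of m "inverse (real (Suc n))"] unfolding m mC .
  have den: "C.mtopology closure_of (?O n) = mspace ?C" for n
  proof (intro subset_antisym subsetI)
    fix f assume f: "f \<in> mspace ?C"
    show "f \<in> C.mtopology closure_of (?O n)"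
      unfolding C.metric_closure_of
    proof (intro CollectI conjI allI impI f)
      fix r :: real assume r: "r > 0"
      have "0 < inverse (real (Suc n))" by simp
      from dense[OF m this r f] obtain g where g: "g \<in> ?O n" "mdist ?C f g < r" by blast
      moreover have "g \<in> mspace ?C" using g(1) m unfolding split_maps_def by blast
      ultimately show "\<exists>y\<in>?O n. y \<in> C.mball f r" using f by (intro bexI[of _ g]) (simp_all del: mspace_cfunspace)
    qed
  qed (metis C.topspace_mtopology closure_of_subset_topspace subsetD)
  have "M.mcomplete" using cptm by (intro M.compact_space_imp_mcomplete) (simp add: mtopology_of_def)
  then have "mcomplete_of (cfunspace X M.Self)" by (rule M.mcomplete_cfunspace)
  then have comp: "C.mcomplete"
    by (simp add: mcomplete_of_def M.Self_def)
  show "mtopology_of ?C closure_of n_dimensional_maps 0 X m = mspace ?C"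
    unfolding eq mC by (rule C.metric_Baire_category[OF comp]) (use op den in auto)
  show "gdelta_in (mtopology_of ?C) (n_dimensional_maps 0 X m)"
    unfolding eq mC by (rule gdelta_in_Inter) (use op open_imp_gdelta_in in auto)
qed

section \<open>Approximation by maps with splitting fibres\<close>

lemma mdist_self [simp]: "x \<in> mspace m \<Longrightarrow> mdist m x x = 0"
  by (simp add: mdist_zero)

text \<open>
  This is uniform continuity for the product uniformity: a basic open set restricts only finitely
  many coordinates, and compactness reduces to finitely many basic open sets.
\<close>
lemma finite_coordinates_control:
  fixes X :: "'i \<Rightarrow> 'a topology"
  assumes cpt: "compact_space (product_topology X I)"
    and \<mu>: "\<And>i. i \<in> I \<Longrightarrow> mtopology_of (\<mu> i) = X i"
    and h: "continuous_map (product_topology X I) (mtopology_of m) h" and "\<epsilon> > 0"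
  shows "\<exists>J \<rho>. finite J \<and> J \<subseteq> I \<and> \<rho> > 0 \<and>
    (\<forall>x\<in>topspace (product_topology X I). \<forall>y\<in>topspace (product_topology X I).
       (\<forall>i\<in>J. mdist (\<mu> i) (x i) (y i) < \<rho>) \<longrightarrow> mdist m (h x) (h y) < \<epsilon>)"
proof -
  let ?T = "product_topology X I"
  interpret N: Metric_space "mspace m" "mdist m" by (rule Metric_space_mspace_mdist)
  have him: "h x \<in> mspace m" if "x \<in> topspace ?T" for x
    using h that by (auto simp: continuous_map_def)
  have coordM: "x i \<in> mspace (\<mu> i)" if "x \<in> topspace ?T" "i \<in> I" for x i
    using that \<mu>[OF that(2)] by (metis PiE_mem topspace_mtopology_of topspace_product_topology)
  have "\<exists>J \<rho>. finite J \<and> J \<subseteq> I \<and> \<rho> > 0 \<and>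
      (\<forall>y\<in>topspace ?T. (\<forall>i\<in>J. mdist (\<mu> i) (x i) (y i) < 2 * \<rho>) \<longrightarrow> mdist m (h x) (h y) < \<epsilon>/2)"
    if x: "x \<in> topspace ?T" for x
  proof -
    have "openin (mtopology_of m) (N.mball (h x) (\<epsilon>/2))" by (simp add: mtopology_of_def)
    then have "openin ?T {y \<in> topspace ?T. h y \<in> N.mball (h x) (\<epsilon>/2)}"
      by (rule openin_continuous_map_preimage[OF h])
    moreover have "x \<in> {y \<in> topspace ?T. h y \<in> N.mball (h x) (\<epsilon>/2)}" using x him \<open>\<epsilon> > 0\<close> by simp
    ultimately obtain U where U: "finite {i \<in> I. U i \<noteq> topspace (X i)}" "\<forall>i\<in>I. openin (X i) (U i)"
      "x \<in> Pi\<^sub>E I U" "Pi\<^sub>E I U \<subseteq> {y \<in> topspace ?T. h y \<in> N.mball (h x) (\<epsilon>/2)}"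
      unfolding openin_product_topology_alt by meson
    define J where "J = {i \<in> I. U i \<noteq> topspace (X i)}"
    have "\<exists>r>0. \<forall>z\<in>mspace (\<mu> i). mdist (\<mu> i) (x i) z < r \<longrightarrow> z \<in> U i" if i: "i \<in> I" for i
    proof -
      interpret Mi: Metric_space "mspace (\<mu> i)" "mdist (\<mu> i)" by (rule Metric_space_mspace_mdist)
      have "openin Mi.mtopology (U i)" "x i \<in> U i" using U i \<mu>[OF i] by (auto simp: mtopology_of_def)
      then obtain r where "r > 0" "Mi.mball (x i) r \<subseteq> U i" unfolding Mi.openin_mtopology by blast
      then show ?thesis using coordM[OF x i] by (intro exI[of _ r]) auto
    qed
    then obtain r where r: "\<And>i. i \<in> I \<Longrightarrow> r i > 0 \<and> (\<forall>z\<in>mspace (\<mu> i). mdist (\<mu> i) (x i) z < r i \<longrightarrow> z \<in> U i)"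
      by metis
    define \<rho> where "\<rho> = Min (insert 1 (r ` J)) / 2"
    have J: "finite J" "J \<subseteq> I" using U(1) by (auto simp: J_def)
    have \<rho>: "\<rho> > 0" "\<And>i. i \<in> J \<Longrightarrow> 2 * \<rho> \<le> r i" using J r by (auto simp: \<rho>_def)
    have "mdist m (h x) (h y) < \<epsilon>/2" if y: "y \<in> topspace ?T" "\<forall>i\<in>J. mdist (\<mu> i) (x i) (y i) < 2 * \<rho>" for y
    proof -
      have "y i \<in> U i" if i: "i \<in> I" for i
      proof (cases "i \<in> J")
        case True
        then show ?thesis using y r[OF i] \<rho>(2)[OF True] coordM[OF y(1) i] by force
      next
        case False
        then show ?thesis using i y(1) by (auto simp: J_def)
      qed
      then have "y \<in> Pi\<^sub>E I U" using y(1) by (auto simp: PiE_iff)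
      then show ?thesis using U(4) by auto
    qed
    then show ?thesis using J \<rho>(1) by (intro exI[of _ J] exI[of _ \<rho>]) auto
  qed
  then obtain J \<rho> where J: "\<And>x. x \<in> topspace ?T \<Longrightarrow> finite (J x) \<and> J x \<subseteq> I \<and> \<rho> x > 0 \<and>
      (\<forall>y\<in>topspace ?T. (\<forall>i\<in>J x. mdist (\<mu> i) (x i) (y i) < 2 * \<rho> x) \<longrightarrow> mdist m (h x) (h y) < \<epsilon>/2)"
    by metis
  define G where "G x = {y \<in> topspace ?T. \<forall>i\<in>J x. mdist (\<mu> i) (x i) (y i) < \<rho> x}" for x
  have G: "openin ?T (G x) \<and> x \<in> G x" if x: "x \<in> topspace ?T" for x
  proof -
    have "openin ?T {y \<in> topspace ?T. y i \<in> Metric_space.mball (mspace (\<mu> i)) (mdist (\<mu> i)) (x i) (\<rho> x)}"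
      if "i \<in> J x" for i
    proof -
      interpret Mi: Metric_space "mspace (\<mu> i)" "mdist (\<mu> i)" by (rule Metric_space_mspace_mdist)
      have i: "i \<in> I" using that J[OF x] by blast
      have "openin (X i) (Mi.mball (x i) (\<rho> x))" using \<mu>[OF i] Mi.openin_mball by (metis mtopology_of_def)
      then show ?thesis by (intro openin_continuous_map_preimage[OF continuous_map_product_projection[OF i]])
    qed
    then have "openin ?T ((\<Inter>i\<in>J x. {y \<in> topspace ?T. y i \<in> Metric_space.mball (mspace (\<mu> i)) (mdist (\<mu> i)) (x i) (\<rho> x)}) \<inter> topspace ?T)"
      using J[OF x] by (intro openin_INT) auto
    also have "\<dots> = G x"
    proof -
      have "y i \<in> Metric_space.mball (mspace (\<mu> i)) (mdist (\<mu> i)) (x i) (\<rho> x) \<longleftrightarrow> mdist (\<mu> i) (x i) (y i) < \<rho> x"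
        if "y \<in> topspace ?T" "i \<in> J x" for y i
      proof -
        have i: "i \<in> I" using that J[OF x] by blast
        show ?thesis
          using coordM[OF x i] coordM[OF that(1) i] by (simp add: Metric_space.in_mball)
      qed
      then show ?thesis unfolding G_def by blast
    qed
    finally have "openin ?T (G x)" .
    moreover have "x \<in> G x"
    proof -
      have "mdist (\<mu> i) (x i) (x i) < \<rho> x" if "i \<in> J x" for i
      proof -
        have "i \<in> I" using that J[OF x] by blast
        then show ?thesis using J[OF x] coordM[OF x] by simp
      qed
      then show ?thesis using x by (simp add: G_def)
    qed
    ultimately show ?thesis by blast
  qed
  obtain K where K: "finite K" "K \<subseteq> topspace ?T" "topspace ?T \<subseteq> (\<Union>x\<in>K. G x)"
    by (rule finite_subcover[OF cpt G])
  define JJ where "JJ = (\<Union>x\<in>K. J x)"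
  define r where "r = Min (insert 1 (\<rho> ` K))"
  have JJ: "finite JJ" "JJ \<subseteq> I" using K J unfolding JJ_def by blast+
  have r: "r > 0" "\<And>x. x \<in> K \<Longrightarrow> r \<le> \<rho> x" using K J by (auto simp: r_def)
  have "mdist m (h y) (h z) < \<epsilon>" if y: "y \<in> topspace ?T" and z: "z \<in> topspace ?T"
    and yz: "\<forall>i\<in>JJ. mdist (\<mu> i) (y i) (z i) < r" for y z
  proof -
    obtain x where x: "x \<in> K" "y \<in> G x" using K y by blast
    then have xT: "x \<in> topspace ?T" using K by blast
    have "mdist (\<mu> i) (x i) (y i) < 2 * \<rho> x \<and> mdist (\<mu> i) (x i) (z i) < 2 * \<rho> x" if i: "i \<in> J x" for i
    proof -
      have iI: "i \<in> I" using i J[OF xT] by blast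
      have "mdist (\<mu> i) (x i) (y i) < \<rho> x" using x i by (simp add: G_def)
      moreover have "mdist (\<mu> i) (y i) (z i) < \<rho> x" using yz i x(1) r(2)[OF x(1)] by (force simp: JJ_def)
      moreover have "mdist (\<mu> i) (x i) (z i) \<le> mdist (\<mu> i) (x i) (y i) + mdist (\<mu> i) (y i) (z i)"
        using coordM iI xT y z by (intro mdist_triangle) auto
      ultimately show ?thesis using J[OF xT] by linarith
    qed
    then have "mdist m (h x) (h y) < \<epsilon>/2" "mdist m (h x) (h z) < \<epsilon>/2" using J[OF xT] y z by auto
    then show ?thesis using N.triangle[of "h y" "h x" "h z"] N.commute[of "h y" "h x"] him xT y z by auto
  qed
  then show ?thesis using JJ r(1) by (intro exI[of _ JJ] exI[of _ r]) auto
qed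

text \<open>The perturbation \<open>g\<^sub>i x = H\<^sub>i (f\<^sub>i x, \<theta>\<^sub>i (x\<^sub>i))\<close> described at the beginning.\<close>
lemma split_maps_dense_product:
  fixes X :: "'i \<Rightarrow> 'a topology"
  assumes \<mu>: "\<And>i. i \<in> I \<Longrightarrow> mtopology_of (\<mu> i) = X i"
    and cptX: "\<And>i. i \<in> I \<Longrightarrow> compact_space (X i)"
    and lcX: "\<And>i. i \<in> I \<Longrightarrow> locally_connected_space (X i)"
    and conX: "\<And>i. i \<in> I \<Longrightarrow> connected_space (X i)"
    and dimX: "\<And>i. i \<in> I \<Longrightarrow> covering_dim_le (X i) 1"
    and neX: "\<And>i. i \<in> I \<Longrightarrow> topspace (X i) \<noteq> {}"
    and ntX: "\<And>i x. i \<in> I \<Longrightarrow> topspace (X i) \<noteq> {x}"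
    and m: "mtopology_of m = product_topology X I"
    and "\<delta> > 0" "\<epsilon> > 0" and f: "f \<in> mspace (cfunspace (product_topology X I) m)"
  shows "\<exists>g\<in>split_maps m m \<delta>. mdist (cfunspace (product_topology X I) m) f g < \<epsilon>"
proof -
  let ?T = "product_topology X I"
  have cpt: "compact_space ?T" using cptX by (simp add: compact_space_product_topology)
  have mT: "mspace m = topspace ?T" using m by (metis topspace_mtopology_of)
  have topi: "Metric_space.mtopology (mspace (\<mu> i)) (mdist (\<mu> i)) = X i" if "i \<in> I" for i
    using \<mu>[OF that] by (simp add: mtopology_of_def)
  have Mi: "mspace (\<mu> i) = topspace (X i)" if "i \<in> I" for i using \<mu>[OF that] by (metis topspace_mtopology_of)
  have coordM: "x i \<in> mspace (\<mu> i)" if "x \<in> topspace ?T" "i \<in> I" for x i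
    using that Mi by (auto simp: PiE_iff)
  have fc: "continuous_map ?T ?T f" using f m by simp
  have e4: "\<epsilon>/4 > 0" "min \<delta> (\<epsilon>/4) > 0" using \<open>\<epsilon> > 0\<close> \<open>\<delta> > 0\<close> by auto
  have fcm: "continuous_map ?T (mtopology_of m) f" and idm: "continuous_map ?T (mtopology_of m) (\<lambda>x. x)"
    using fc m by (auto simp: continuous_map_id[unfolded id_def])
  obtain J1 \<rho>1 where J1: "finite J1" "J1 \<subseteq> I" "\<rho>1 > 0" "\<And>x y. \<lbrakk>x \<in> topspace ?T; y \<in> topspace ?T;
       \<forall>i\<in>J1. mdist (\<mu> i) (x i) (y i) < \<rho>1\<rbrakk> \<Longrightarrow> mdist m (f x) (f y) < \<epsilon>/4"
    using finite_coordinates_control[OF cpt \<mu> fcm e4(1)] by metis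
  obtain J2 \<rho>2 where J2: "finite J2" "J2 \<subseteq> I" "\<rho>2 > 0" "\<And>x y. \<lbrakk>x \<in> topspace ?T; y \<in> topspace ?T;
       \<forall>i\<in>J2. mdist (\<mu> i) (x i) (y i) < \<rho>2\<rbrakk> \<Longrightarrow> mdist m x y < min \<delta> (\<epsilon>/4)"
    using finite_coordinates_control[OF cpt \<mu> idm e4(2)] by metis
  define J where "J = J1 \<union> J2"
  have J: "finite J" "J \<subseteq> I" using J1 J2 by (auto simp: J_def)
  have "\<forall>i. \<exists>a. i \<in> I \<longrightarrow> a \<in> topspace (X i)" using neX by blast
  then obtain a where "\<And>i. i \<in> I \<Longrightarrow> a i \<in> topspace (X i)" by metis
  then have b: "restrict a I \<in> topspace ?T" by simp
  define b where "b = restrict a I"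
  note b = b[folded b_def]
  \<comment> \<open>The coordinates outside \<open>J\<close> are frozen at those of \<open>b\<close> before \<open>f\<close> is applied. Otherwise the oscillation
    of the \<open>f\<^sub>i\<close> with \<open>i \<in> J\<close> would be controlled by further coordinates, in which the fibres of \<open>g\<close> are
    not known to split.\<close>
  define \<pi> where "\<pi> x = (\<lambda>i\<in>I. if i \<in> J then x i else b i)" for x :: "'i \<Rightarrow> 'a"
  have \<pi>c: "continuous_map ?T ?T \<pi>"
    unfolding continuous_map_componentwise
  proof (intro conjI ballI)
    fix k assume k: "k \<in> I"
    show "continuous_map ?T (X k) (\<lambda>x. \<pi> x k)"
      using continuous_map_product_projection[OF k, of X] b k by (cases "k \<in> J") (auto simp: \<pi>_def PiE_iff)
  qed (auto simp: \<pi>_def)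
  have \<pi>T: "\<pi> x \<in> topspace ?T" if "x \<in> topspace ?T" for x
    using \<pi>c that by (auto simp: continuous_map_def)
  define f' where "f' x = f (\<pi> x)" for x
  have f'c: "continuous_map ?T ?T f'"
    using continuous_map_compose[OF \<pi>c fc] by (simp add: f'_def[abs_def] o_def)
  have f'T: "f' x \<in> topspace ?T" if "x \<in> topspace ?T" for x
    using f'c that by (auto simp: continuous_map_def)
  have ff': "mdist m (f x) (f' x) < \<epsilon>/4" if x: "x \<in> topspace ?T" for x
    unfolding f'_def
  proof (rule J1(4)[OF x \<pi>T[OF x]], rule ballI)
    fix i assume "i \<in> J1"
    then have i: "i \<in> I" "i \<in> J" using J1 by (auto simp: J_def)
    then show "mdist (\<mu> i) (x i) (\<pi> x i) < \<rho>1" using coordM[OF x i(1)] J1(3) by (simp add: \<pi>_def)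
  qed
  have "\<exists>H \<kappa>. continuous_map (prod_topology (X i) euclideanreal) (X i) H \<and> \<kappa> > 0 \<and>
      (\<forall>y\<in>mspace (\<mu> i). \<forall>t. mdist (\<mu> i) y (H (y, t)) < \<rho>2) \<and>
      (\<forall>y\<in>mspace (\<mu> i). \<forall>w. \<exists>t\<in>{0..1}. \<forall>y'\<in>mspace (\<mu> i). mdist (\<mu> i) y y' < \<kappa> \<longrightarrow> H (y', t) \<noteq> w)"
    if i: "i \<in> I" for i
  proof -
    interpret M: Metric_space "mspace (\<mu> i)" "mdist (\<mu> i)" by (rule Metric_space_mspace_mdist)
    note t = topi[OF i]
    have "\<exists>H. continuous_map (prod_topology M.mtopology euclideanreal) M.mtopology H \<and>
      (\<forall>y\<in>mspace (\<mu> i). (\<forall>t. mdist (\<mu> i) y (H (y, t)) < \<rho>2) \<and> (\<exists>t\<in>{0..1}. \<exists>t'\<in>{0..1}. H (y, t) \<noteq> H (y, t')))"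
      by (rule M.nonconstant_motion)
        (use i t cptX lcX conX dimX neX ntX J2(3) Mi in auto)
    then obtain H where H: "continuous_map (prod_topology M.mtopology euclideanreal) M.mtopology H"
      "\<forall>y\<in>mspace (\<mu> i). \<forall>t. mdist (\<mu> i) y (H (y, t)) < \<rho>2"
      "\<forall>y\<in>mspace (\<mu> i). \<exists>t\<in>{0..1}. \<exists>t'\<in>{0..1}. H (y, t) \<noteq> H (y, t')" by blast
    have "\<exists>\<kappa>>0. \<forall>y\<in>mspace (\<mu> i). \<forall>w. \<exists>t\<in>{0..1}. \<forall>y'\<in>M.mball y \<kappa>. H (y', t) \<noteq> w"
      by (rule M.nonconstant_motion_avoids[OF _ H(1)]) (use i t cptX H(3) in auto)
    then obtain \<kappa> where "\<kappa> > 0" "\<forall>y\<in>mspace (\<mu> i). \<forall>w. \<exists>t\<in>{0..1}. \<forall>y'\<in>M.mball y \<kappa>. H (y', t) \<noteq> w" by blast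
    moreover from this have "\<forall>y\<in>mspace (\<mu> i). \<forall>w. \<exists>t\<in>{0..1}.
        \<forall>y'\<in>mspace (\<mu> i). mdist (\<mu> i) y y' < \<kappa> \<longrightarrow> H (y', t) \<noteq> w"
      unfolding M.in_mball Ball_def by blast
    ultimately show ?thesis using H(1,2) unfolding t by blast
  qed
  then obtain H \<kappa> where H: "\<And>i. i \<in> I \<Longrightarrow> continuous_map (prod_topology (X i) euclideanreal) (X i) (H i)"
    and \<kappa>: "\<And>i. i \<in> I \<Longrightarrow> \<kappa> i > 0"
    and Hnear: "\<And>i y t. i \<in> I \<Longrightarrow> y \<in> mspace (\<mu> i) \<Longrightarrow> mdist (\<mu> i) y (H i (y, t)) < \<rho>2"
    and Havoid: "\<And>i y w. i \<in> I \<Longrightarrow> y \<in> mspace (\<mu> i) \<Longrightarrow>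
        \<exists>t\<in>{0..1}. \<forall>y'\<in>mspace (\<mu> i). mdist (\<mu> i) y y' < \<kappa> i \<longrightarrow> H i (y', t) \<noteq> w"
    by metis
  have "\<exists>r>0. \<forall>x\<in>topspace ?T. \<forall>y\<in>topspace ?T. (\<forall>j\<in>J. mdist (\<mu> j) (x j) (y j) < r) \<longrightarrow>
      mdist (\<mu> i) (f' x i) (f' y i) < \<kappa> i" if i: "i \<in> I" for i
  proof -
    have c: "continuous_map ?T (mtopology_of (\<mu> i)) (\<lambda>x. f x i)"
      using continuous_map_compose[OF fc continuous_map_product_projection[OF i]] \<mu>[OF i] by (simp add: o_def)
    obtain L r where L: "finite L" "L \<subseteq> I" "r > 0" "\<And>x y. \<lbrakk>x \<in> topspace ?T; y \<in> topspace ?T;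
       \<forall>j\<in>L. mdist (\<mu> j) (x j) (y j) < r\<rbrakk> \<Longrightarrow> mdist (\<mu> i) (f x i) (f y i) < \<kappa> i"
      using finite_coordinates_control[OF cpt \<mu> c \<kappa>[OF i]] by metis
    have "mdist (\<mu> i) (f' x i) (f' y i) < \<kappa> i"
      if x: "x \<in> topspace ?T" and y: "y \<in> topspace ?T" and xy: "\<forall>j\<in>J. mdist (\<mu> j) (x j) (y j) < r" for x y
      unfolding f'_def
    proof (rule L(4)[OF \<pi>T[OF x] \<pi>T[OF y]], rule ballI)
      fix j assume "j \<in> L"
      then have j: "j \<in> I" using L by blast
      then show "mdist (\<mu> j) (\<pi> x j) (\<pi> y j) < r"
        using xy L(3) coordM[OF b j] by (simp add: \<pi>_def)
    qed
    then show ?thesis using L(3) by blast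
  qed
  then obtain r where r: "\<And>i. i \<in> I \<Longrightarrow> r i > 0"
    and osc: "\<And>i x y. \<lbrakk>i \<in> I; x \<in> topspace ?T; y \<in> topspace ?T; \<forall>j\<in>J. mdist (\<mu> j) (x j) (y j) < r i\<rbrakk> \<Longrightarrow>
      mdist (\<mu> i) (f' x i) (f' y i) < \<kappa> i"
    by metis
  define \<rho> where "\<rho> = Min (insert \<rho>2 (r ` J))"
  have \<rho>: "\<rho> > 0" "\<rho> \<le> \<rho>2" "\<And>i. i \<in> J \<Longrightarrow> \<rho> \<le> r i" using J r J2(3) by (auto simp: \<rho>_def)
  have "\<exists>\<theta>. continuous_map (X i) euclideanreal \<theta> \<and>
    (\<forall>t\<in>{0..1}. \<forall>x\<in>mspace (\<mu> i). \<theta> x \<noteq> t \<longrightarrow>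
      (\<exists>U. openin (X i) U \<and> x \<in> U \<and> (\<forall>a\<in>U. \<forall>c\<in>U. mdist (\<mu> i) a c < \<rho>/2) \<and> X i closure_of U \<subseteq> U \<union> {z. \<theta> z = t}))"
    if i: "i \<in> I" for i
  proof -
    interpret M: Metric_space "mspace (\<mu> i)" "mdist (\<mu> i)" by (rule Metric_space_mspace_mdist)
    have p: "compact_space M.mtopology" "covering_dim_le M.mtopology 1" "\<rho>/2 > 0"
      using i cptX dimX \<rho>(1) by (auto simp: topi[OF i])
    show ?thesis using M.dim_1_separating_function[OF p] unfolding topi[OF i] M.small_def by blast
  qed
  then obtain \<theta> where \<theta>c: "\<And>i. i \<in> I \<Longrightarrow> continuous_map (X i) euclideanreal (\<theta> i)"
    and \<theta>: "\<And>i t x. \<lbrakk>i \<in> I; t \<in> {0..1}; x \<in> mspace (\<mu> i); \<theta> i x \<noteq> t\<rbrakk> \<Longrightarrow>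
      \<exists>U. openin (X i) U \<and> x \<in> U \<and> (\<forall>a\<in>U. \<forall>c\<in>U. mdist (\<mu> i) a c < \<rho>/2) \<and> X i closure_of U \<subseteq> U \<union> {z. \<theta> i z = t}"
    by metis
  \<comment> \<open>The pieces have diameter below \<open>\<rho> / 2\<close>, so even points of their closures are \<open>\<rho>\<close>-close.\<close>
  define g0 where "g0 x = (\<lambda>i\<in>I. if i \<in> J then H i (f' x i, \<theta> i (x i)) else f' x i)" for x
  have g0c: "continuous_map ?T ?T g0"
    unfolding continuous_map_componentwise
  proof (intro conjI ballI)
    fix k assume k: "k \<in> I"
    have c1: "continuous_map ?T (X k) (\<lambda>x. f' x k)"
      using continuous_map_compose[OF f'c continuous_map_product_projection[OF k]] by (simp add: o_def)
    have c2: "continuous_map ?T euclideanreal (\<lambda>x. \<theta> k (x k))"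
      using continuous_map_compose[OF continuous_map_product_projection[OF k, of X] \<theta>c[OF k]] by (simp add: o_def)
    have "continuous_map ?T (X k) (\<lambda>x. H k (f' x k, \<theta> k (x k)))"
      using continuous_map_compose[OF continuous_map_pairedI[OF c1 c2] H[OF k]] by (simp add: o_def)
    then show "continuous_map ?T (X k) (\<lambda>x. g0 x k)" using c1 k by (cases "k \<in> J") (auto simp: g0_def)
  qed (auto simp: g0_def)
  have g0T: "g0 x \<in> topspace ?T" if "x \<in> topspace ?T" for x
    using g0c that by (auto simp: continuous_map_def)
  define g where "g = restrict g0 (topspace ?T)"
  have gc: "continuous_map ?T ?T g" using g0c by (rule continuous_map_eq) (simp add: g_def)
  have gC: "g \<in> mspace (cfunspace ?T m)"
    using cpt gc g0T m mT
    by (subst compactin_mspace_cfunspace) (auto simp: compact_space_def g_def)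
  have near: "mdist m (f x) (g x) \<le> \<epsilon>/2" if x: "x \<in> topspace ?T" for x
  proof -
    have "mdist m (f' x) (g0 x) < min \<delta> (\<epsilon>/4)"
    proof (rule J2(4)[OF f'T[OF x] g0T[OF x]], rule ballI)
      fix i assume "i \<in> J2"
      then have i: "i \<in> I" "i \<in> J" using J2 by (auto simp: J_def)
      then show "mdist (\<mu> i) (f' x i) (g0 x i) < \<rho>2"
        using Hnear[OF i(1) coordM[OF f'T[OF x] i(1)]] by (simp add: g0_def)
    qed
    moreover have "mdist m (f x) (g0 x) \<le> mdist m (f x) (f' x) + mdist m (f' x) (g0 x)"
      using fc x f'T[OF x] g0T[OF x] by (intro mdist_triangle) (auto simp: mT continuous_map_def)
    ultimately show ?thesis using ff'[OF x] x by (simp add: g_def)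
  qed
  have dist: "mdist (cfunspace ?T m) f g < \<epsilon>"
    using mdist_cfunspace_le[of "\<epsilon>/2" ?T m f g] near \<open>\<epsilon> > 0\<close> by force
  have "\<exists>U V. openin (mtopology_of m) U \<and> openin (mtopology_of m) V \<and> disjnt U V \<and> x \<in> U \<and>
        {z \<in> mspace m. g z = g x} \<subseteq> U \<union> V \<and> (\<forall>a\<in>U. \<forall>c\<in>U. mdist m a c < \<delta>)" if xm: "x \<in> mspace m" for x
  proof -
    have x: "x \<in> topspace ?T" using xm mT by simp
    have gval: "g z i = H i (f' z i, \<theta> i (z i))" if "i \<in> J" "z \<in> topspace ?T" for i z
      using that J by (auto simp: g_def g0_def)
    have "\<exists>t U. t \<in> {0..1} \<and> (\<forall>y'\<in>mspace (\<mu> i). mdist (\<mu> i) (f' x i) y' < \<kappa> i \<longrightarrow> H i (y', t) \<noteq> g x i) \<and>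
        openin (X i) U \<and> x i \<in> U \<and> (\<forall>a\<in>U. \<forall>c\<in>U. mdist (\<mu> i) a c < \<rho>/2) \<and> X i closure_of U \<subseteq> U \<union> {z. \<theta> i z = t}"
      if iJ: "i \<in> J" for i
    proof -
      have i: "i \<in> I" using iJ J by blast
      obtain t where t: "t \<in> {0..1}" "\<forall>y'\<in>mspace (\<mu> i). mdist (\<mu> i) (f' x i) y' < \<kappa> i \<longrightarrow> H i (y', t) \<noteq> g x i"
        using Havoid[OF i coordM[OF f'T[OF x] i], of "g x i"] by blast
      have "mdist (\<mu> i) (f' x i) (f' x i) < \<kappa> i" using \<kappa>[OF i] coordM[OF f'T[OF x] i] by simp
      then have "H i (f' x i, t) \<noteq> g x i" using t(2) coordM[OF f'T[OF x] i] by blast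
      then have "\<theta> i (x i) \<noteq> t" using gval[OF iJ x] by auto
      from \<theta>[OF i t(1) coordM[OF x i] this] show ?thesis using t by blast
    qed
    then obtain t U where tU: "\<And>i. i \<in> J \<Longrightarrow> t i \<in> {0..1::real} \<and>
        (\<forall>y'\<in>mspace (\<mu> i). mdist (\<mu> i) (f' x i) y' < \<kappa> i \<longrightarrow> H i (y', t i) \<noteq> g x i) \<and>
        openin (X i) (U i) \<and> x i \<in> U i \<and> (\<forall>a\<in>U i. \<forall>c\<in>U i. mdist (\<mu> i) a c < \<rho>/2) \<and> X i closure_of (U i) \<subseteq> U i \<union> {z. \<theta> i z = t i}"
      by metis
    define B where "B = {z \<in> topspace ?T. \<forall>i\<in>J. z i \<in> U i}"
    define B' where "B' = {z \<in> topspace ?T. \<forall>i\<in>J. z i \<in> X i closure_of (U i)}"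
    have "openin ?T ((\<Inter>i\<in>J. {z \<in> topspace ?T. z i \<in> U i}) \<inter> topspace ?T)"
    proof (intro openin_INT J(1))
      fix i assume "i \<in> J"
      then show "openin ?T {z \<in> topspace ?T. z i \<in> U i}"
        using tU J by (intro openin_continuous_map_preimage[OF continuous_map_product_projection[of i I X]]) auto
    qed
    also have "((\<Inter>i\<in>J. {z \<in> topspace ?T. z i \<in> U i}) \<inter> topspace ?T) = B" by (auto simp: B_def)
    finally have Bo: "openin ?T B" .
    have "openin ?T (\<Union>i\<in>J. {z \<in> topspace ?T. z i \<in> topspace (X i) - X i closure_of (U i)})"
    proof (intro openin_Union ballI)
      fix S assume "S \<in> (\<lambda>i. {z \<in> topspace ?T. z i \<in> topspace (X i) - X i closure_of (U i)}) ` J"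
      then obtain i where i: "i \<in> J" "S = {z \<in> topspace ?T. z i \<in> topspace (X i) - X i closure_of (U i)}" by blast
      show "openin ?T S" unfolding i
        using J i(1) by (intro openin_continuous_map_preimage[OF continuous_map_product_projection[of i I X]] openin_diff) auto
    qed
    also have "(\<Union>i\<in>J. {z \<in> topspace ?T. z i \<in> topspace (X i) - X i closure_of (U i)}) = topspace ?T - B'"
    proof -
      have "z i \<in> topspace (X i)" if "z \<in> topspace ?T" "i \<in> J" for z i
        using that J(2) by (auto simp: PiE_iff)
      then show ?thesis unfolding B'_def by blast
    qed
    finally have Vo: "openin ?T (topspace ?T - B')" .
    have BB': "B \<subseteq> B'"
    proof
      fix z assume z: "z \<in> B"
      have "z i \<in> X i closure_of (U i)" if "i \<in> J" for i
        using z that tU[OF that] closure_of_subset[OF openin_subset, of "X i" "U i"] by (auto simp: B_def)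
      then show "z \<in> B'" using z by (simp add: B_def B'_def)
    qed
    \<comment> \<open>The fibre meets the closed box \<open>B'\<close> in the open box \<open>B\<close> only.\<close>
    have fibre: "z \<in> B" if z: "z \<in> topspace ?T" "g z = g x" "z \<in> B'" for z
    proof -
      have close: "mdist (\<mu> j) (x j) (z j) < \<rho>" if j: "j \<in> J" for j
      proof -
        interpret M: Metric_space "mspace (\<mu> j)" "mdist (\<mu> j)" by (rule Metric_space_mspace_mdist)
        have jI: "j \<in> I" using j J by blast
        have "z j \<in> M.mtopology closure_of (U j)" using z(3) j by (simp add: B'_def topi[OF jI])
        then have "\<forall>r>0. \<exists>a\<in>U j. a \<in> M.mball (z j) r" unfolding M.metric_closure_of by blast
        moreover have "\<rho>/2 > 0" using \<rho>(1) by simp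
        ultimately obtain a where a: "a \<in> U j" "a \<in> M.mball (z j) (\<rho>/2)" by blast
        have "mdist (\<mu> j) (x j) a < \<rho>/2" using tU[OF j] a by blast
        then show ?thesis using a(2) M.triangle[of "x j" a "z j"] M.commute[of a "z j"] coordM[OF x jI] by auto
      qed
      have "z i \<in> U i" if iJ: "i \<in> J" for i
      proof -
        have i: "i \<in> I" using iJ J by blast
        have "mdist (\<mu> i) (f' x i) (f' z i) < \<kappa> i"
          using close \<rho>(3)[OF iJ] by (intro osc[OF i x z(1)]) force
        then have "H i (f' z i, t i) \<noteq> g x i" using tU[OF iJ] coordM[OF f'T[OF z(1)] i] by blast
        then have "\<theta> i (z i) \<noteq> t i" using gval[OF iJ z(1)] z(2) by auto
        then show ?thesis using z(3) iJ tU[OF iJ] by (auto simp: B'_def)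
      qed
      then show ?thesis using z(1) by (simp add: B_def)
    qed
    have sm: "mdist m a c < \<delta>" if ac: "a \<in> B" "c \<in> B" for a c
    proof -
      have "mdist (\<mu> i) (a i) (c i) < \<rho>2" if "i \<in> J2" for i
      proof -
        have "i \<in> J" using that by (simp add: J_def)
        then have "mdist (\<mu> i) (a i) (c i) < \<rho>/2" using ac tU by (auto simp: B_def)
        then show ?thesis using \<rho> by simp
      qed
      then have "mdist m a c < min \<delta> (\<epsilon>/4)" using ac by (intro J2(4)) (auto simp: B_def)
      then show ?thesis by simp
    qed
    have "x \<in> B" using x tU by (auto simp: B_def)
    moreover have "disjnt B (topspace ?T - B')" using BB' by (auto simp: disjnt_iff)
    moreover have "{z \<in> mspace m. g z = g x} \<subseteq> B \<union> (topspace ?T - B')" using fibre mT by blast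
    moreover have "\<forall>a\<in>B. \<forall>c\<in>B. mdist m a c < \<delta>" using sm by blast
    ultimately show ?thesis unfolding m using Bo Vo by blast
  qed
  then have "g \<in> split_maps m m \<delta>" unfolding split_maps_def m using gC m by auto
  then show ?thesis using dist by blast
qed

lemma covering_dim_le_subsingleton:
  assumes "topspace X \<subseteq> {x}"
  shows "covering_dim_le X n"
  unfolding covering_dim_le_def
proof (intro allI impI)
  fix \<U> assume U: "finite \<U> \<and> (\<forall>U\<in>\<U>. openin X U) \<and> \<Union>\<U> = topspace X"
  show "\<exists>\<V>. finite \<V> \<and> (\<forall>V\<in>\<V>. openin X V) \<and> \<Union>\<V> = topspace X \<and> (\<forall>V\<in>\<V>. \<exists>U\<in>\<U>. V \<subseteq> U) \<and>
            (\<forall>x\<in>topspace X. card {V \<in> \<V>. x \<in> V} \<le> n + 1)"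
  proof (cases "x \<in> topspace X")
    case True
    then obtain V where V: "V \<in> \<U>" "x \<in> V" using U by blast
    have "card {W \<in> {topspace X}. y \<in> W} \<le> card {topspace X}" for y by (rule card_mono) auto
    then have "card {W \<in> {topspace X}. y \<in> W} \<le> n + 1" for y by (rule order_trans) simp
    moreover have "topspace X \<subseteq> V" using V assms by blast
    ultimately show ?thesis using V by (intro exI[of _ "{topspace X}"]) blast
  next
    case False
    then have "topspace X = {}" using assms by blast
    then show ?thesis by (intro exI[of _ "{}"]) simp
  qed
qed

theorem theorem8p5:
  fixes X :: "'i \<Rightarrow> 'a topology" and I :: "'i set"
  assumes "countable I"
    and "\<And>i. i \<in> I \<Longrightarrow> curve (X i)"
    and "\<And>i. i \<in> I \<Longrightarrow> locally_connected_space (X i)"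
  shows "zero_DIM (product_topology X I)"
proof -
  have cont: "metrizable_space (X i)" "compact_space (X i)" "connected_space (X i)" "covering_dim_le (X i) 1"
    "\<not> covering_dim_le (X i) 0" if "i \<in> I" for i
    using assms(2)[OF that] by (auto simp: curve_def continuum_def)
  have nt: "topspace (X i) \<noteq> {}" "topspace (X i) \<noteq> {x}" if "i \<in> I" for i x
    using cont(5)[OF that] covering_dim_le_subsingleton[of "X i" x 0] by auto
  have "\<exists>\<mu>. mtopology_of \<mu> = X i" if "i \<in> I" for i
    using cont(1)[OF that] Metric_space.mtopology_of unfolding metrizable_space_def by metis
  then obtain \<mu> where \<mu>: "\<And>i. i \<in> I \<Longrightarrow> mtopology_of (\<mu> i) = X i" by metis
  show ?thesis
  proof (rule zero_DIM_I)
    show "compact_space (product_topology X I)" using cont(2) by (simp add: compact_space_product_topology)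
    show "metrizable_space (product_topology X I)"
      using cont(1) countable_subset[OF _ assms(1)] by (auto simp: metrizable_space_product_topology)
    fix m \<delta> \<epsilon> f
    assume m: "mtopology_of m = product_topology X I" and "(0::real) < \<delta>" "(0::real) < \<epsilon>"
      and f: "f \<in> mspace (cfunspace (product_topology X I) m)"
    show "\<exists>g\<in>split_maps m m \<delta>. mdist (cfunspace (product_topology X I) m) f g < \<epsilon>"
      by (rule split_maps_dense_product[where \<mu> = \<mu>, OF _ _ _ _ _ _ _ m \<open>0 < \<delta>\<close> \<open>0 < \<epsilon>\<close> f])
        (use \<mu> cont assms(3) nt in blast)+
  qed
qed

end
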